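(* Let $n\ge 1$, let $\theta=(w,b)\in\mathbb{R}^{n\times n}\times\mathbb{R}^n$, let $e:\{0,1\}^n\to\mathbb{R}$ be a cost function, and let $J(\theta)=\sum_{x\in\{0,1\}^n}e(x)\,\pi_\theta(x)$ be the stationary cost of the Little model. For integers $M^0,M^1\geq 1$ let $v$ be the random direction and $\Delta^{MVD}_{M^0,M^1}$ the random real number produced by the gradient estimation algorithm for the Little model described in the context, started from an arbitrary fixed initial state $x(0)\in\{0,1\}^n$. Then $$\lim_{M^0\to\infty,\;M^1\to\infty}\mathbb{E}\left[\Delta^{MVD}_{M^0,M^1}\,v\right]=\nabla_\theta J(\theta),$$ where both sides are identified with elements of $\mathbb{R}^{n\times n}\times\mathbb{R}^n$.
   Context: Little model. State space $X=\{0,1\}^n$. Let $\sigma(s)=1/(1+e^{-s})$. For $\theta=(w,b)\in\mathbb{R}^{n\times n}\times\mathbb{R}^n$ and $x\in X$ let $u_i(x,\theta)=\sum_{j=1}^n w_{i,j}x_j+b_i$. The Markov kernel is $$P_\theta(x^0,x^1)=\prod_{i=1}^n\sigma(u_i(x^0,\theta))^{x_i^1}\,(1-\sigma(u_i(x^0,\theta)))^{1-x_i^1},\qquad x^0,x^1\in X.$$ It has a unique stationary distribution $\pi_\theta$, i.e. $\pi_\theta P_\theta=\pi_\theta$. Equivalently, one step of the chain is $x(t+1)=f(x(t),\theta,\xi(t+1))$, where $f_i(x,\theta,\xi)=1$ if $u_i(x,\theta)>\xi_i$ and $f_i(x,\theta,\xi)=0$ otherwise, and the coordinates $\xi_i(t)$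 are i.i.d. with the logistic distribution (cumulative distribution function $\sigma$). The map $\theta\mapsto J(\theta)$ is a differentiable function on $\mathbb{R}^{n\times n}\times\mathbb{R}^n$. Directions. A direction is $v\in\mathbb{R}^{n\times n}\times\mathbb{R}^n$, with entries $v_{i,j}$ (for the weight $w_{i,j}$) and $v_i$ (for the bias $b_i$). For a real $\gamma$, $\gamma_+=\max\{0,\gamma\}$ and $\gamma_-=\max\{0,-\gamma\}$. Put $$c_{\theta,v}(x^0)=\sum_{i=1}^n|v_i|\,\sigma(u_i(x^0,\theta))+\sum_{i=1}^n\sum_{j=1}^n|v_{i,j}|\,x_j^0\,\sigma(u_i(x^0,\theta)).$$ Sequential sampler. Given data $c,d,a_1,\dots,a_n,\beta_1,\dots,\beta_n$, it generates $(x_1,\dots,x_n)\in\{0,1\}^n$ as follows: $x_1=1$ with probability $\frac1c\beta_1\left(d+a_1+\sum_{i=2}^n a_i\beta_i\right)$ and otherwise $x_1=0$; then for $k=2,\dots,n$, given $x_1,\dots,x_{k-1}$, $x_k=1$ with probability $$\frac{\left(d+\sum_{i=1}^{k-1}a_ix_i+a_k+\sum_{i=k+1}^n\beta_ia_i\right)\beta_k}{d+\sum_{i=1}^{k-1}a_ix_i+\sum_{i=k}^n\beta_ia_i}$$ and otherwise $x_k=0$ (on prefixes reached with probability zero the choice is arbitrary). Data "plus" at $x^0$: $d=\sum_{i}\sum_j\sigma(u_i(x^0,\theta))(v_{i,j})_-x_j^0+\sum_i\sigma(u_i(x^0,\theta))(v_i)_-$, $a_i=(v_i)_++\sum_j(v_{i,j})_+x_j^0$,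 $\beta_i=\sigma(u_i(x^0,\theta))$, $c=c_{\theta,v}(x^0)$. Data "minus" at $x^0$: the same with the subscripts $+$ and $-$ (positive and negative parts) interchanged in $d$ and in $a_i$. Gradient estimation algorithm for the Little model, with parameters $M^0,M^1$: 1. Draw $v\in\{-1,1\}^{n\times n}\times\{-1,1\}^n$ with independent entries, each equal to $\pm1$ with probability $1/2$. 2. Independently of $v$, run the chain: for $t=0,\dots,M^0-1$ sample $x(t+1)$ from $P_\theta(x(t),\cdot)$. Put $x^0=x(M^0)$. 3. Given $v$ and $x^0$, let $x^+(0)$ be the output of the sequential sampler run with the "plus" data at $x^0$, and $x^-(0)$ the output of the sequential sampler run with the "minus" data at $x^0$. 4. For $t=0,\dots,M^1-1$, using common random numbers (the same fresh noise vector $\xi(t+1)$, independent of everything before, for both chains), set $x^{\pm}(t+1)=f(x^{\pm}(t),\theta,\xi(t+1))$, so that each of $x^+$, $x^-$ evolves according to $P_\theta$. 5. Set $\Delta^{MVD}_{M^0,M^1}=c_{\theta,v}(x(M^0))\sum_{t=0}^{M^1}\left[e(x^+(t))-e(x^-(t))\right]$. The estimator is the vector $\Delta^{MVD}_{M^0,M^1}\,v$. *)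

theory Defs
  imports "HOL-Probability.Probability"
begin

section \<open>The Little model\<close>

text \<open>
  The \<open>n\<close> sites are the elements of a nonempty finite linearly ordered type \<open>'n\<close>, with
  \<open>n = CARD('n)\<close>; the order is needed only by the sequential sampler, which visits the sites one
  after the other. A parameter (or a direction) is a pair of a matrix, whose entry \<open>fst \<theta> $ i $ j\<close>
  is \<open>w\<^sub>i\<^sub>,\<^sub>j\<close>, and a vector of biases.
\<close>

type_synonym 'n state = "'n \<Rightarrow> bool"
type_synonym 'n param = "((real, 'n) vec, 'n) vec \<times> (real, 'n) vec"

definition sigma :: "real \<Rightarrow> real" where
  "sigma s = 1 / (1 + exp (- s))"

definition potential :: "'n::finite param \<Rightarrow> 'n state \<Rightarrow> 'n \<Rightarrow> real" where
  "potential \<theta> x i = (\<Sum>j\<in>UNIV. fst \<theta> $ i $ j * of_bool (x j)) + snd \<theta> $ i"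

definition little_kernel :: "'n::finite param \<Rightarrow> 'n state \<Rightarrow> 'n state \<Rightarrow> real" where
  "little_kernel \<theta> x0 x1 =
     (\<Prod>i\<in>UNIV. sigma (potential \<theta> x0 i) ^ of_bool (x1 i)
              * (1 - sigma (potential \<theta> x0 i)) ^ (1 - of_bool (x1 i)))"

text \<open>The law \<open>P\<^sub>\<theta>(x0, \<cdot>)\<close>; \<open>pmf_little_step\<close> below shows that the embedding is legitimate.\<close>

definition little_step :: "'n::finite param \<Rightarrow> 'n state \<Rightarrow> 'n state pmf" where
  "little_step \<theta> x0 = embed_pmf (little_kernel \<theta> x0)"

lemma sigma_pos: "0 < sigma s" and sigma_less_1: "sigma s < 1"
  by (simp_all add: sigma_def add_pos_pos)

lemma little_kernel_conv_Pi_pmf: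
  "little_kernel \<theta> x0 x1 = pmf (Pi_pmf UNIV False (\<lambda>i. bernoulli_pmf (sigma (potential \<theta> x0 i)))) x1"
proof -
  have "0 \<le> sigma s" "sigma s \<le> 1" for s
    using sigma_pos[of s] sigma_less_1[of s] by auto
  then show ?thesis
    by (subst pmf_Pi) (auto simp: little_kernel_def intro!: prod.cong)
qed

lemma pmf_little_step: "pmf (little_step \<theta> x0) x1 = little_kernel \<theta> x0 x1"
proof -
  have "little_kernel \<theta> x0 = pmf (Pi_pmf UNIV False (\<lambda>i. bernoulli_pmf (sigma (potential \<theta> x0 i))))"
    by (rule ext) (rule little_kernel_conv_Pi_pmf)
  then show ?thesis
    by (simp add: little_step_def type_definition.Rep_inverse[OF td_pmf_embed_pmf])
qed

definition stationary :: "'n::finite param \<Rightarrow> 'n state pmf \<Rightarrow> bool" where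
  "stationary \<theta> p \<longleftrightarrow> (\<forall>y. (\<Sum>x\<in>UNIV. pmf p x * little_kernel \<theta> x y) = pmf p y)"

definition stationary_dist :: "'n::finite param \<Rightarrow> 'n state pmf" where
  "stationary_dist \<theta> = (THE p. stationary \<theta> p)"

definition stationary_cost :: "('n::finite state \<Rightarrow> real) \<Rightarrow> 'n param \<Rightarrow> real" where
  "stationary_cost e \<theta> = (\<Sum>x\<in>UNIV. e x * pmf (stationary_dist \<theta>) x)"

primrec little_chain :: "'n::finite param \<Rightarrow> 'n state \<Rightarrow> nat \<Rightarrow> 'n state pmf" where
  "little_chain \<theta> x 0 = return_pmf x"
| "little_chain \<theta> x (Suc t) = bind_pmf (little_chain \<theta> x t) (little_step \<theta>)"


section \<open>The noise-driven form of the chain\<close>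

definition little_map :: "'n::finite param \<Rightarrow> 'n state \<Rightarrow> ('n \<Rightarrow> real) \<Rightarrow> 'n state" where
  "little_map \<theta> x \<xi> = (\<lambda>i. potential \<theta> x i > \<xi> i)"

text \<open>The noise at time 0 is never used: the step from \<open>t\<close> to \<open>t + 1\<close> consumes \<open>\<xi> (t + 1)\<close>.\<close>

primrec trajectory ::
  "'n::finite param \<Rightarrow> (nat \<Rightarrow> 'n \<Rightarrow> real) \<Rightarrow> 'n state \<Rightarrow> nat \<Rightarrow> 'n state" where
  "trajectory \<theta> \<xi> x 0 = x"
| "trajectory \<theta> \<xi> x (Suc t) = little_map \<theta> (trajectory \<theta> \<xi> x t) (\<xi> (Suc t))"

text \<open>\<open>interval_measure F\<close> is the Borel measure on the line with distribution function \<open>F\<close>.\<close>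

definition logistic_distribution :: "real measure" where
  "logistic_distribution = interval_measure sigma"

lemma real_distribution_logistic: "real_distribution logistic_distribution"
  and cdf_logistic: "cdf logistic_distribution = sigma"
proof -
  have mono: "sigma x \<le> sigma y" if "x \<le> y" for x y
    using that by (auto simp: sigma_def intro!: divide_left_mono mult_pos_pos add_pos_pos)
  have cont: "continuous (at_right a) sigma" for a
  proof -
    have "1 + exp (- s) \<noteq> 0" for s :: real
      by (metis add_pos_pos exp_gt_zero less_irrefl zero_less_one)
    then show ?thesis
      unfolding sigma_def by (intro continuous_intros) auto
  qed
  have bot: "(sigma \<longlongrightarrow> 0) at_bot"
    unfolding sigma_def
    by (intro tendsto_divide_0[OF tendsto_const] filterlim_at_top_imp_at_infinity
          filterlim_tendsto_add_at_top[OF tendsto_const] filterlim_compose[OF exp_at_top]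
          filterlim_uminus_at_top_at_bot)
  have top: "(sigma \<longlongrightarrow> 1) at_top"
  proof -
    have "((\<lambda>s::real. 1 / (1 + exp (- s))) \<longlongrightarrow> 1 / (1 + 0)) at_top"
      by (intro tendsto_intros filterlim_compose[OF exp_at_bot] filterlim_uminus_at_bot_at_top) auto
    then show ?thesis
      by (simp add: sigma_def[abs_def])
  qed
  show "real_distribution logistic_distribution"
    unfolding logistic_distribution_def
    by (rule real_distribution_interval_measure) (use mono cont bot top in auto)
  show "cdf logistic_distribution = sigma"
    unfolding logistic_distribution_def
    by (rule cdf_interval_measure) (use mono cont bot top in auto)
qed

text \<open>The law of the noise vectors \<open>(\<xi>(t))\<^sub>t\<close>: all coordinates \<open>\<xi>\<^sub>i(t)\<close> are i.i.d. logistic.\<close>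

definition noise_law :: "(nat \<Rightarrow> 'n::finite \<Rightarrow> real) measure" where
  "noise_law = (\<Pi>\<^sub>M t\<in>UNIV. \<Pi>\<^sub>M i\<in>UNIV. logistic_distribution)"


section \<open>The sequential sampler\<close>

text \<open>
  \<open>sampler_prob c d a \<beta> k x\<close> is the probability of setting site \<open>k\<close> to 1, given the values \<open>x i\<close>
  for \<open>i < k\<close>. Two conventions make this total: division by zero yields 0, and \<open>bernoulli_pmf\<close>
  truncates its argument to \<open>[0, 1]\<close>. For directions with entries \<open>\<plusminus>1\<close> neither
  of them ever comes into play.
\<close>

definition sampler_prob ::
  "real \<Rightarrow> real \<Rightarrow> ('n \<Rightarrow> real) \<Rightarrow> ('n \<Rightarrow> real) \<Rightarrow> 'n::{finite,linorder} \<Rightarrow> 'n state \<Rightarrow> real" where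
  "sampler_prob c d a \<beta> k x =
     (if k = Min UNIV then 1 / c * \<beta> k * (d + a k + (\<Sum>i\<in>{k<..}. a i * \<beta> i))
      else ((d + (\<Sum>i\<in>{..<k}. a i * of_bool (x i)) + a k + (\<Sum>i\<in>{k<..}. \<beta> i * a i)) * \<beta> k)
           / (d + (\<Sum>i\<in>{..<k}. a i * of_bool (x i)) + (\<Sum>i\<in>{k..}. \<beta> i * a i)))"

primrec sample_sites ::
  "real \<Rightarrow> real \<Rightarrow> ('n \<Rightarrow> real) \<Rightarrow> ('n \<Rightarrow> real) \<Rightarrow> 'n::{finite,linorder} list \<Rightarrow> 'n state \<Rightarrow> 'n state pmf"
where
  "sample_sites c d a \<beta> [] x = return_pmf x"
| "sample_sites c d a \<beta> (k # ks) x =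
     bind_pmf (bernoulli_pmf (sampler_prob c d a \<beta> k x)) (\<lambda>y. sample_sites c d a \<beta> ks (x(k := y)))"

text \<open>The initial state below is a placeholder: every site is overwritten before it is read.\<close>

definition sequential_sampler ::
  "real \<Rightarrow> real \<Rightarrow> ('n \<Rightarrow> real) \<Rightarrow> ('n \<Rightarrow> real) \<Rightarrow> 'n::{finite,linorder} state pmf" where
  "sequential_sampler c d a \<beta> = sample_sites c d a \<beta> (sorted_list_of_set UNIV) (\<lambda>_. False)"

definition pos_part :: "real \<Rightarrow> real" where "pos_part \<gamma> = max 0 \<gamma>"
definition neg_part :: "real \<Rightarrow> real" where "neg_part \<gamma> = max 0 (- \<gamma>)"

definition c_weight :: "'n::finite param \<Rightarrow> 'n param \<Rightarrow> 'n state \<Rightarrow> real" where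
  "c_weight \<theta> v x0 =
     (\<Sum>i\<in>UNIV. \<bar>snd v $ i\<bar> * sigma (potential \<theta> x0 i))
     + (\<Sum>i\<in>UNIV. \<Sum>j\<in>UNIV. \<bar>fst v $ i $ j\<bar> * of_bool (x0 j) * sigma (potential \<theta> x0 i))"

text \<open>In the next two definitions \<open>h\<close> is \<open>pos_part\<close> or \<open>neg_part\<close>.\<close>

definition data_d :: "(real \<Rightarrow> real) \<Rightarrow> 'n::finite param \<Rightarrow> 'n param \<Rightarrow> 'n state \<Rightarrow> real" where
  "data_d h \<theta> v x0 =
     (\<Sum>i\<in>UNIV. \<Sum>j\<in>UNIV. sigma (potential \<theta> x0 i) * h (fst v $ i $ j) * of_bool (x0 j))
     + (\<Sum>i\<in>UNIV. sigma (potential \<theta> x0 i) * h (snd v $ i))"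

definition data_a :: "(real \<Rightarrow> real) \<Rightarrow> 'n::finite param \<Rightarrow> 'n state \<Rightarrow> 'n \<Rightarrow> real" where
  "data_a h v x0 i = h (snd v $ i) + (\<Sum>j\<in>UNIV. h (fst v $ i $ j) * of_bool (x0 j))"

definition sampler_plus ::
  "'n::{finite,linorder} param \<Rightarrow> 'n param \<Rightarrow> 'n state \<Rightarrow> 'n state pmf" where
  "sampler_plus \<theta> v x0 =
     sequential_sampler (c_weight \<theta> v x0) (data_d neg_part \<theta> v x0) (data_a pos_part v x0)
       (\<lambda>i. sigma (potential \<theta> x0 i))"

definition sampler_minus ::
  "'n::{finite,linorder} param \<Rightarrow> 'n param \<Rightarrow> 'n state \<Rightarrow> 'n state pmf" where
  "sampler_minus \<theta> v x0 =
     sequential_sampler (c_weight \<theta> v x0) (data_d pos_part \<theta> v x0) (data_a neg_part v x0)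
       (\<lambda>i. sigma (potential \<theta> x0 i))"


section \<open>The gradient estimation algorithm\<close>

definition direction_law :: "'n::finite param pmf" where
  "direction_law =
     do {
       vw \<leftarrow> Pi_pmf (UNIV :: ('n \<times> 'n) set) 0 (\<lambda>_. pmf_of_set {-1, 1 :: real});
       vb \<leftarrow> Pi_pmf (UNIV :: 'n set) 0 (\<lambda>_. pmf_of_set {-1, 1 :: real});
       return_pmf ((\<chi> i j. vw (i, j)), (\<chi> i. vb i))
     }"

text \<open>
  The algorithm prescribes the conditional law of \<open>x\<^sup>+(0)\<close> and that of \<open>x\<^sup>-(0)\<close> given the direction
  \<open>v\<close> and the state \<open>x0 = x(M\<^sup>0)\<close>, but not how the two samples are coupled. The coupling is
  therefore a parameter \<open>K\<close>, where \<open>K v x0\<close> is the joint conditional law of \<open>(x\<^sup>+(0), x\<^sup>-(0))\<close>.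
\<close>

definition sampler_coupling ::
  "'n::{finite,linorder} param \<Rightarrow> ('n param \<Rightarrow> 'n state \<Rightarrow> ('n state \<times> 'n state) pmf) \<Rightarrow> bool" where
  "sampler_coupling \<theta> K \<longleftrightarrow>
     (\<forall>v x0. map_pmf fst (K v x0) = sampler_plus \<theta> v x0 \<and>
             map_pmf snd (K v x0) = sampler_minus \<theta> v x0)"

lemma sampler_coupling_independent:
  "sampler_coupling \<theta> (\<lambda>v x0. pair_pmf (sampler_plus \<theta> v x0) (sampler_minus \<theta> v x0))"
  by (simp add: sampler_coupling_def map_fst_pair_pmf map_snd_pair_pmf)

text \<open>The joint law of \<open>(v, x(M\<^sup>0), x\<^sup>+(0), x\<^sup>-(0))\<close>.\<close>

definition start_law ::
  "'n::{finite,linorder} param \<Rightarrow> ('n param \<Rightarrow> 'n state \<Rightarrow> ('n state \<times> 'n state) pmf)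
   \<Rightarrow> 'n state \<Rightarrow> nat \<Rightarrow> ('n param \<times> 'n state \<times> 'n state \<times> 'n state) pmf" where
  "start_law \<theta> K x M0 =
     do {
       v \<leftarrow> direction_law;
       x0 \<leftarrow> little_chain \<theta> x M0;
       (xp, xm) \<leftarrow> K v x0;
       return_pmf (v, x0, xp, xm)
     }"

definition run_law ::
  "'n::{finite,linorder} param \<Rightarrow> ('n param \<Rightarrow> 'n state \<Rightarrow> ('n state \<times> 'n state) pmf)
   \<Rightarrow> 'n state \<Rightarrow> nat
   \<Rightarrow> (('n param \<times> 'n state \<times> 'n state \<times> 'n state) \<times> (nat \<Rightarrow> 'n \<Rightarrow> real)) measure" where
  "run_law \<theta> K x M0 = measure_pmf (start_law \<theta> K x M0) \<Otimes>\<^sub>M noise_law"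

text \<open>\<open>mvd_delta\<close> and \<open>direction\<close> are random variables on the sample space of \<open>run_law\<close>.\<close>

definition mvd_delta ::
  "('n::finite state \<Rightarrow> real) \<Rightarrow> 'n param \<Rightarrow> nat
   \<Rightarrow> ('n param \<times> 'n state \<times> 'n state \<times> 'n state) \<times> (nat \<Rightarrow> 'n \<Rightarrow> real) \<Rightarrow> real" where
  "mvd_delta e \<theta> M1 = (\<lambda>((v, x0, xp, xm), \<xi>).
     c_weight \<theta> v x0 * (\<Sum>t=0..M1. e (trajectory \<theta> \<xi> xp t) - e (trajectory \<theta> \<xi> xm t)))"

definition direction ::
  "('n::finite param \<times> 'n state \<times> 'n state \<times> 'n state) \<times> (nat \<Rightarrow> 'n \<Rightarrow> real) \<Rightarrow> 'n param" where
  "direction \<omega> = fst (fst \<omega>)"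

end

theory Submission
  imports Defs
begin

text \<open>
  The estimator is unbiased up to two truncations in time, and both errors vanish because the Little
  chain has a strictly positive kernel \<open>P\<^sub>\<theta>\<close> on a finite state space.

  Write \<open>\<pi>\<^sub>\<theta>\<close> for the stationary law and \<open>g = (\<Sum>t. P\<^sub>\<theta>\<^sup>t e - J(\<theta>))\<close> for the solution of Poisson's equation
  \<open>g - P\<^sub>\<theta> g = e - J(\<theta>)\<close>; positivity of the kernel makes the series converge geometrically. Integrating
  Poisson's equation against \<open>\<pi>\<^sub>\<eta>\<close>, for another parameter \<open>\<eta>\<close>, gives the exact identity
  \<open>J(\<eta>) - J(\<theta>) = \<pi>\<^sub>\<eta> (P\<^sub>\<eta> - P\<^sub>\<theta>) g\<close> (lemma \<open>stationary_perturbation\<close>). The same identity for indicator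
  costs shows that \<open>\<pi>\<^sub>\<eta>\<close> is continuous in \<open>\<eta>\<close>. Hence \<open>J\<close> is differentiable, with derivative
  \<open>D\<^sub>v J = \<pi>\<^sub>\<theta> (D\<^sub>v P\<^sub>\<theta>) g\<close> in direction \<open>v\<close>, which involves the derivative of the kernel alone
  (\<open>has_derivative_stationary_mean\<close>).

  For the estimator, \<open>D\<^sub>v P\<^sub>\<theta>(x, y)\<close> is \<open>P\<^sub>\<theta>(x, y)\<close> times the score \<open>(\<Sum>i. (y\<^sub>i - \<sigma>(u\<^sub>i)) \<alpha>\<^sub>i)\<close>, where
  \<open>\<alpha>\<^sub>i = v\<^sub>i + (\<Sum>j. v\<^sub>i\<^sub>j x\<^sub>j)\<close>. Splitting the entries of \<open>v\<close> into positive and negative parts writes the score as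
  a difference of two nonnegative affine functions of \<open>y\<close> with the same mean \<open>c\<close> under \<open>P\<^sub>\<theta>(x, \<cdot>)\<close>. The
  sequential sampler draws exactly from \<open>P\<^sub>\<theta>(x, \<cdot>)\<close> reweighted by such a function: it fixes the sites one by
  one according to their conditional probabilities (\<open>pmf_sample_sites\<close>). So \<open>c\<close> times the difference of
  the two sampler laws is \<open>D\<^sub>v P\<^sub>\<theta>(x, \<cdot>)\<close> (\<open>sampler_difference\<close>).

  The noise-driven trajectories started from the two samples have the law of the chain, and by linearity
  the conditional expectation of \<open>\<Delta>\<close> given \<open>v\<close> does not depend on how they are coupled. It is
  \<open>\<mu> (D\<^sub>v P\<^sub>\<theta>) (\<Sum>t\<le>M\<^sup>1. P\<^sub>\<theta>\<^sup>t e)\<close>, where \<open>\<mu>\<close> is the law of the chain at time \<open>M\<^sup>0\<close> (\<open>expectation_estimator\<close>). As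
  \<open>D\<^sub>v P\<^sub>\<theta>\<close> annihilates constants, \<open>J(\<theta>)\<close> may be subtracted from every \<open>P\<^sub>\<theta>\<^sup>t e\<close>, so this expression tends to
  \<open>D\<^sub>v J\<close> when \<open>M\<^sup>0\<close> and \<open>M\<^sup>1\<close> tend to infinity, independently of each other. Finally, independent random signs
  are uncorrelated with unit variance, so the mean of \<open>D\<^sub>v J\<close> times \<open>v\<close> is the gradient
  (\<open>average_over_directions\<close>).
\<close>

section \<open>Markov chains with a positive kernel on a finite state space\<close>

definition mean :: "'a::finite pmf \<Rightarrow> ('a \<Rightarrow> real) \<Rightarrow> real" where
  "mean p f = (\<Sum>x\<in>UNIV. pmf p x * f x)"

definition average :: "('a::finite \<Rightarrow> 'a pmf) \<Rightarrow> ('a \<Rightarrow> real) \<Rightarrow> 'a \<Rightarrow> real" where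
  "average k f = (\<lambda>x. mean (k x) f)"

text \<open>
  Invariance is tested against functions, which is the form in which it is applied; for the balance
  equations at the individual states see \<open>invariant_iff\<close>.
\<close>

definition invariant :: "('a::finite \<Rightarrow> 'a pmf) \<Rightarrow> 'a pmf \<Rightarrow> bool" where
  "invariant k p \<longleftrightarrow> (\<forall>f. mean p (average k f) = mean p f)"

lemma sum_pmf_UNIV: "(\<Sum>x\<in>UNIV. pmf p x) = (1::real)" for p :: "'a::finite pmf"
  using sum_pmf_eq_1[of UNIV p] by simp

lemma expectation_eq_mean: "measure_pmf.expectation p f = mean p f"
  unfolding mean_def by (subst integral_measure_pmf_real[of UNIV]) (auto simp: mult.commute)

lemma mean_const [simp]: "mean p (\<lambda>_. c) = c"
  by (simp add: mean_def sum_pmf_UNIV flip: sum_distrib_right)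

lemma mean_diff: "mean p (\<lambda>x. f x - g x) = mean p f - mean p g"
  by (simp add: mean_def sum_subtractf algebra_simps)

lemma mean_mono: "(\<And>x. f x \<le> g x) \<Longrightarrow> mean p f \<le> mean p g"
  unfolding mean_def by (intro sum_mono mult_left_mono) auto

lemma mean_indicator: "mean p (\<lambda>x. of_bool (x = y)) = pmf p y"
  by (simp add: mean_def of_bool_def if_distrib cong: if_cong)

lemma mean_return_pmf [simp]: "mean (return_pmf x) f = f x"
  by (simp add: mean_def pmf_return of_bool_def indicator_def if_distrib if_distribR cong: if_cong)

lemma mean_bind_pmf: "mean (bind_pmf p k) f = mean p (average k f)"
  using pmf_expectation_bind[of UNIV k p f]
  by (simp add: expectation_eq_mean average_def) (simp add: mean_def)

lemma average_diff: "average k (\<lambda>x. f x - g x) = (\<lambda>x. average k f x - average k g x)"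
  by (simp add: average_def mean_diff)

text \<open>
  Moving laws forward in time is dual to averaging functions backward in time. By this duality every
  statement about the chain becomes one about the iterates of \<open>average k\<close>.
\<close>

lemma mean_chain:
  "mean (((\<lambda>q. bind_pmf q k) ^^ t) p) f = mean p ((average k ^^ t) f)"
proof (induction t arbitrary: f)
  case (Suc t)
  show ?case
    by (simp add: mean_bind_pmf Suc.IH) (simp flip: funpow_swap1)
qed simp

lemma invariant_funpow:
  assumes "invariant k p"
  shows "mean p ((average k ^^ t) f) = mean p f"
  using assms by (induction t) (auto simp: invariant_def)

lemma invariant_iff:
  "invariant k p \<longleftrightarrow> (\<forall>y. (\<Sum>x\<in>UNIV. pmf p x * pmf (k x) y) = pmf p y)"
proof
  assume "invariant k p"
  then have "mean p (average k (\<lambda>z. of_bool (z = y))) = mean p (\<lambda>z. of_bool (z = y))" for y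
    by (simp add: invariant_def)
  then show "\<forall>y. (\<Sum>x\<in>UNIV. pmf p x * pmf (k x) y) = pmf p y"
    by (simp add: average_def mean_indicator) (simp add: mean_def)
next
  assume *: "\<forall>y. (\<Sum>x\<in>UNIV. pmf p x * pmf (k x) y) = pmf p y"
  have "mean p (average k f) = mean p f" for f
  proof -
    have "mean p (average k f) = (\<Sum>x\<in>UNIV. \<Sum>y\<in>UNIV. pmf p x * pmf (k x) y * f y)"
      by (simp add: mean_def average_def sum_distrib_left mult.assoc)
    also have "\<dots> = (\<Sum>y\<in>UNIV. (\<Sum>x\<in>UNIV. pmf p x * pmf (k x) y) * f y)"
      by (subst sum.swap) (simp add: sum_distrib_right)
    finally show ?thesis
      using * by (simp add: mean_def)
  qed
  then show "invariant k p"
    by (simp add: invariant_def)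
qed

text \<open>
  Doeblin's contraction. The average of \<open>f\<close> seen from \<open>x\<close> gives weight at least \<open>\<delta>\<close> to a minimiser of \<open>f\<close>, so
  it lies below the maximum by at least \<open>\<delta>\<close> times the oscillation, while the average seen from \<open>y\<close> is
  at least the minimum.
\<close>

lemma average_oscillation:
  fixes k :: "'a::finite \<Rightarrow> 'a pmf"
  assumes \<delta>: "\<And>x y. \<delta> \<le> pmf (k x) y" "0 \<le> \<delta>" "\<delta> \<le> 1"
    and B: "\<And>x y. f x - f y \<le> B"
  shows "average k f x - average k f y \<le> (1 - \<delta>) * B"
proof -
  obtain hi where hi: "\<And>z. f z \<le> f hi"
    using finite_imageI[of UNIV f] Max_in[of "range f"] Max_ge[of "range f"] by fastforce
  obtain lo where lo: "\<And>z. f lo \<le> f z"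
    using finite_imageI[of UNIV f] Min_in[of "range f"] Min_le[of "range f"] by fastforce
  have "average k f x = f hi - mean (k x) (\<lambda>z. f hi - f z)"
    by (simp add: average_def mean_diff)
  moreover have "pmf (k x) lo * (f hi - f lo) \<le> mean (k x) (\<lambda>z. f hi - f z)"
    unfolding mean_def by (rule member_le_sum) (auto simp: hi)
  moreover have "\<delta> * (f hi - f lo) \<le> pmf (k x) lo * (f hi - f lo)"
    using \<delta>(1) lo by (intro mult_right_mono) auto
  ultimately have "average k f x \<le> f hi - \<delta> * (f hi - f lo)"
    by linarith
  moreover have "f lo \<le> average k f y"
    using mean_mono[of "\<lambda>_. f lo" f "k y"] lo by (simp add: average_def)
  ultimately have "average k f x - average k f y \<le> (1 - \<delta>) * (f hi - f lo)"
    by (simp add: algebra_simps)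
  also have "\<dots> \<le> (1 - \<delta>) * B"
    using B \<delta> by (intro mult_left_mono) auto
  finally show ?thesis .
qed

lemma deviation_from_mean:
  assumes "\<And>y. \<bar>f x - f y\<bar> \<le> B"
  shows "\<bar>f x - mean p f\<bar> \<le> B"
proof -
  have "f x - mean p f = mean p (\<lambda>y. f x - f y)"
    by (simp add: mean_diff)
  moreover have "mean p (\<lambda>y. f x - f y) \<le> mean p (\<lambda>_. B)"
    using assms by (intro mean_mono) (auto dest: abs_le_D1)
  moreover have "mean p (\<lambda>_. - B) \<le> mean p (\<lambda>y. f x - f y)"
    using assms by (intro mean_mono) (smt (verit))
  ultimately show ?thesis
    by simp
qed

lemma ex_oscillation_bound: "\<exists>B. \<forall>x y. \<bar>f x - f y\<bar> \<le> (B::real)" for f :: "'a::finite \<Rightarrow> real"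
proof -
  have "\<bar>f x - f y\<bar> \<le> Max (range (\<lambda>(x, y). \<bar>f x - f y\<bar>))" for x y
    by (rule Max_ge) auto
  then show ?thesis
    by blast
qed

locale positive_kernel =
  fixes k :: "'a::finite \<Rightarrow> 'a pmf"
  assumes positive: "0 < pmf (k x) y"
begin

lemma geometric_oscillation:
  obtains r B where "0 \<le> r" "r < 1" "\<And>t x y. \<bar>(average k ^^ t) f x - (average k ^^ t) f y\<bar> \<le> r ^ t * B"
proof -
  obtain B where B: "\<And>x y. \<bar>f x - f y\<bar> \<le> B"
    using ex_oscillation_bound by blast
  define \<delta> where "\<delta> = Min (range (\<lambda>(x, y). pmf (k x) y))"
  have le: "\<delta> \<le> pmf (k x) y" for x y
    unfolding \<delta>_def by (rule Min_le) auto
  have "\<delta> \<in> range (\<lambda>(x, y). pmf (k x) y)"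
    unfolding \<delta>_def by (rule Min_in) auto
  then have \<delta>: "0 < \<delta>" "\<delta> \<le> 1"
    using positive pmf_le_1 by auto
  have "(average k ^^ t) f x - (average k ^^ t) f y \<le> (1 - \<delta>) ^ t * B" for t x y
  proof (induction t arbitrary: x y)
    case 0
    then show ?case
      using B[of x y] by auto
  next
    case (Suc t)
    show ?case
      using average_oscillation[where k = k and x = x and y = y, OF le _ _ Suc.IH] \<delta>
      by (simp add: mult.assoc)
  qed
  then have "\<bar>(average k ^^ t) f x - (average k ^^ t) f y\<bar> \<le> (1 - \<delta>) ^ t * B" for t x y
    by (smt (verit))
  then show ?thesis
    using \<delta> that[of "1 - \<delta>" B] by auto
qed

text \<open>
  One more averaging step replaces the value at \<open>x\<close> by a mean of the values at all states, hence moves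
  it by no more than the oscillation. The successive increments are therefore geometrically small.
\<close>

lemma convergent_iterates: "convergent (\<lambda>t. (average k ^^ t) f x)"
proof -
  obtain r B where r: "0 \<le> r" "r < 1"
    and osc: "\<And>t x y. \<bar>(average k ^^ t) f x - (average k ^^ t) f y\<bar> \<le> r ^ t * B"
    using geometric_oscillation by blast
  have "norm ((average k ^^ Suc t) f x - (average k ^^ t) f x) \<le> r ^ t * B" for t
    using deviation_from_mean[where x = x and p = "k x" and f = "(average k ^^ t) f" and B = "r ^ t * B"] osc
    by (simp add: average_def abs_minus_commute)
  then have "summable (\<lambda>t. (average k ^^ Suc t) f x - (average k ^^ t) f x)"
    using r
    by (intro summable_comparison_test'[where N = 0, OF summable_mult2[where c = B, OF summable_geometric[of r]]])
       auto
  then have "convergent (\<lambda>n. \<Sum>t<n. (average k ^^ Suc t) f x - (average k ^^ t) f x)"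
    by (simp add: summable_iff_convergent)
  then have "convergent (\<lambda>n. (average k ^^ n) f x - f x)"
    by (simp add: sum_lessThan_telescope[of "\<lambda>t. (average k ^^ t) f x"] del: funpow.simps)
  then show ?thesis
    by (simp add: convergent_diff_const_right_iff)
qed

text \<open>
  The laws of the chain started at any fixed state converge, and their limit is invariant because
  shifting the time by one does not change it.
\<close>

lemma ex_invariant: "\<exists>p. invariant k p"
proof -
  fix x :: 'a
  let ?q = "\<lambda>t. ((\<lambda>q. bind_pmf q k) ^^ t) (return_pmf x)"
  have iter: "(average k ^^ t) f x = mean (?q t) f" for t f
    by (simp add: mean_chain)
  define \<pi> where "\<pi> y = lim (\<lambda>t. pmf (?q t) y)" for y
  have lim: "(\<lambda>t. pmf (?q t) y) \<longlonglongrightarrow> \<pi> y" for y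
    unfolding \<pi>_def convergent_LIMSEQ_iff[symmetric]
    using convergent_iterates[of "\<lambda>z. of_bool (z = y)" x] by (simp add: iter mean_indicator)
  have \<pi>_lim: "(\<lambda>t. mean (?q t) f) \<longlonglongrightarrow> (\<Sum>y\<in>UNIV. \<pi> y * f y)" for f
    unfolding mean_def by (intro tendsto_intros lim)
  have nonneg: "0 \<le> \<pi> y" for y
    by (rule LIMSEQ_le_const[OF lim]) auto
  have "(\<Sum>y\<in>UNIV. \<pi> y) = 1"
    using LIMSEQ_unique[OF \<pi>_lim[of "\<lambda>_. 1"]] by simp
  then have sum1: "(\<integral>\<^sup>+ y. ennreal (\<pi> y) \<partial>count_space UNIV) = 1"
    using nonneg by (simp add: nn_integral_count_space_finite sum_ennreal)
  have mean: "mean (embed_pmf \<pi>) f = (\<Sum>y\<in>UNIV. \<pi> y * f y)" for f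
    by (simp add: mean_def pmf_embed_pmf[OF nonneg sum1])
  have "mean (embed_pmf \<pi>) (average k f) = mean (embed_pmf \<pi>) f" for f
  proof (rule LIMSEQ_unique)
    show "(\<lambda>t. mean (?q (Suc t)) f) \<longlonglongrightarrow> mean (embed_pmf \<pi>) f"
      unfolding mean by (rule LIMSEQ_Suc[OF \<pi>_lim])
    show "(\<lambda>t. mean (?q (Suc t)) f) \<longlonglongrightarrow> mean (embed_pmf \<pi>) (average k f)"
      using \<pi>_lim[of "average k f"] by (simp add: mean mean_bind_pmf)
  qed
  then show ?thesis
    by (auto simp: invariant_def)
qed

text \<open>
  The mean of \<open>f\<close> under an invariant law is also the mean of each iterate, which differs from every
  single value of that iterate by at most the oscillation.
\<close>

lemma geometric_convergence:
  assumes "invariant k p"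
  obtains r B where "0 \<le> r" "r < 1" "\<And>t x. \<bar>(average k ^^ t) f x - mean p f\<bar> \<le> r ^ t * B"
proof -
  obtain r B where "0 \<le> r" "r < 1"
    and osc: "\<And>t x y. \<bar>(average k ^^ t) f x - (average k ^^ t) f y\<bar> \<le> r ^ t * B"
    using geometric_oscillation by blast
  moreover have "\<bar>(average k ^^ t) f x - mean p f\<bar> \<le> r ^ t * B" for t x
    using deviation_from_mean[where x = x and p = p and f = "(average k ^^ t) f" and B = "r ^ t * B"] osc
    by (simp add: invariant_funpow[OF assms])
  ultimately show ?thesis
    using that by blast
qed

lemma iterates_tendsto_mean:
  assumes "invariant k p"
  shows "(\<lambda>t. (average k ^^ t) f x) \<longlonglongrightarrow> mean p f"
proof -
  obtain r B where r: "0 \<le> r" "r < 1" "\<And>t x. \<bar>(average k ^^ t) f x - mean p f\<bar> \<le> r ^ t * B"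
    using geometric_convergence[OF assms] by blast
  have "(\<lambda>t. r ^ t * B) \<longlonglongrightarrow> 0"
    using r by (intro tendsto_mult_left_zero LIMSEQ_power_zero) auto
  then have "(\<lambda>t. (average k ^^ t) f x - mean p f) \<longlonglongrightarrow> 0"
    by (rule Lim_null_comparison[rotated]) (use r in auto)
  then show ?thesis
    by (simp add: LIM_zero_iff)
qed

lemma invariant_unique:
  assumes "invariant k p" "invariant k q"
  shows "p = q"
proof (rule pmf_eqI)
  fix y
  have "mean p (\<lambda>x. of_bool (x = y)) = mean q (\<lambda>x. of_bool (x = y))"
    by (rule LIMSEQ_unique[OF iterates_tendsto_mean[OF assms(1)] iterates_tendsto_mean[OF assms(2)]])
  then show "pmf p y = pmf q y"
    by (simp add: mean_indicator)
qed

lemma ex1_invariant: "\<exists>!p. invariant k p"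
  using ex_invariant invariant_unique by blast

text \<open>
  The total transient excess of the cost \<open>f\<close> of a chain started at \<open>x\<close> over the stationary mean; it is
  the solution of Poisson's equation proved below.
\<close>

definition poisson_solution :: "'a pmf \<Rightarrow> ('a \<Rightarrow> real) \<Rightarrow> 'a \<Rightarrow> real" where
  "poisson_solution p f x = (\<Sum>t. (average k ^^ t) f x - mean p f)"

lemma poisson_solution_sums:
  assumes "invariant k p"
  shows "(\<lambda>t. (average k ^^ t) f x - mean p f) sums poisson_solution p f x"
proof -
  obtain r B where r: "0 \<le> r" "r < 1" "\<And>t x. \<bar>(average k ^^ t) f x - mean p f\<bar> \<le> r ^ t * B"
    using geometric_convergence[OF assms] by blast
  then have "summable (\<lambda>t. (average k ^^ t) f x - mean p f)"
    by (intro summable_comparison_test'[where N = 0, OF summable_mult2[where c = B, OF summable_geometric[of r]]])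
       auto
  then show ?thesis
    by (simp add: poisson_solution_def summable_sums)
qed

text \<open>
  Averaging shifts the defining series by one step, so that only its term at time 0 is lost.
\<close>

lemma poisson_equation:
  assumes "invariant k p"
  shows "poisson_solution p f x - average k (poisson_solution p f) x = f x - mean p f"
proof -
  have "(\<lambda>t. average k (\<lambda>y. (average k ^^ t) f y - mean p f) x) sums average k (poisson_solution p f) x"
    unfolding average_def mean_def
    by (intro sums_sum sums_mult poisson_solution_sums[unfolded average_def mean_def])
       (rule assms)
  then have "(\<lambda>t. (average k ^^ Suc t) f x - mean p f) sums average k (poisson_solution p f) x"
    by (simp add: average_diff) (simp add: average_def)
  moreover have "(\<lambda>t. (average k ^^ Suc t) f x - mean p f) sums (poisson_solution p f x - (f x - mean p f))"
    using poisson_solution_sums[OF assms, of f x] by (subst sums_Suc_iff) auto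
  ultimately show ?thesis
    using sums_unique2 by fastforce
qed

text \<open>
  This identity is exact, not a first-order expansion. By Poisson's equation for \<open>k\<close> the excess
  \<open>f - mean p f\<close> is \<open>g - average k g\<close>, where \<open>g\<close> is the Poisson solution. Under \<open>q\<close> the function \<open>g\<close> has
  the same mean as \<open>average k' g\<close>, so only the difference of the two kernels remains.
\<close>

lemma stationary_perturbation:
  assumes "invariant k p" "invariant k' q"
  shows "mean q f - mean p f
       = (\<Sum>x\<in>UNIV. pmf q x * (\<Sum>y\<in>UNIV. (pmf (k' x) y - pmf (k x) y) * poisson_solution p f y))"
proof -
  let ?g = "poisson_solution p f"
  have "mean q f - mean p f = mean q (\<lambda>x. ?g x - average k ?g x)"
    by (simp add: poisson_equation[OF assms(1)] mean_diff)
  also have "\<dots> = mean q (\<lambda>x. average k' ?g x - average k ?g x)"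
    using assms(2) by (simp add: mean_diff invariant_def)
  finally show ?thesis
    by (simp add: mean_def average_def left_diff_distrib sum_subtractf)
qed

end

text \<open>
  Where one factor vanishes, the product rule requires only continuity of the other factor. The factor
  \<open>a\<close> will be a stationary probability, whose differentiability is not known beforehand.
\<close>

lemma has_derivative_mult_vanishing:
  fixes a F :: "'b::real_normed_vector \<Rightarrow> real"
  assumes F: "(F has_derivative F') (at x)" "F x = 0" and a: "(a \<longlongrightarrow> a x) (at x)"
  shows "((\<lambda>y. a y * F y) has_derivative (\<lambda>h. a x * F' h)) (at x)"
proof -
  have lin: "bounded_linear F'"
    by (rule has_derivative_bounded_linear[OF F(1)])
  then obtain C where C: "\<And>h. norm (F' h) \<le> norm h * C"
    using bounded_linear.bounded by blast
  have "((\<lambda>y. \<bar>a y\<bar> * (norm (F y - F x - F' (y - x)) / norm (y - x)) + \<bar>a y - a x\<bar> * C)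
          \<longlongrightarrow> \<bar>a x\<bar> * 0 + 0 * C) (at x)"
    using F(1) a
    by (intro tendsto_intros tendsto_rabs_zero) (auto simp: has_derivative_iff_norm LIM_zero_iff)
  then have "((\<lambda>y. \<bar>a y\<bar> * (norm (F y - F x - F' (y - x)) / norm (y - x)) + \<bar>a y - a x\<bar> * C) \<longlongrightarrow> 0) (at x)"
    by simp
  then have "((\<lambda>y. norm (a y * F y - a x * F x - a x * F' (y - x)) / norm (y - x)) \<longlongrightarrow> 0) (at x)"
  proof (rule Lim_null_comparison[rotated], intro eventually_at_topological[THEN iffD2] exI[of _ UNIV] conjI ballI impI)
    fix y assume "y \<noteq> x"
    have "norm (a y * F y - a x * F x - a x * F' (y - x))
        = \<bar>a y * (F y - F x - F' (y - x)) + (a y - a x) * F' (y - x)\<bar>"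
      using F(2) by (simp add: algebra_simps)
    also have "\<dots> \<le> \<bar>a y\<bar> * norm (F y - F x - F' (y - x)) + \<bar>a y - a x\<bar> * norm (F' (y - x))"
      by (metis abs_mult abs_triangle_ineq real_norm_def)
    also have "\<dots> \<le> \<bar>a y\<bar> * norm (F y - F x - F' (y - x)) + \<bar>a y - a x\<bar> * (norm (y - x) * C)"
      using C by (intro add_left_mono mult_left_mono) auto
    finally show "norm (norm (a y * F y - a x * F x - a x * F' (y - x)) / norm (y - x))
        \<le> \<bar>a y\<bar> * (norm (F y - F x - F' (y - x)) / norm (y - x)) + \<bar>a y - a x\<bar> * C"
      using \<open>y \<noteq> x\<close> by (simp add: field_simps)
  qed auto
  then show ?thesis
    using bounded_linear_const_mult[OF lin, of "a x"] by (simp add: has_derivative_iff_norm)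
qed

text \<open>
  Freeze the Poisson solution at \<open>\<theta>\<close> and use the exact perturbation identity. As the stationary
  probabilities are bounded by 1, it first shows that they are continuous at \<open>\<theta>\<close>; the product rule
  for a vanishing factor then differentiates the same identity.
\<close>

lemma has_derivative_stationary_mean:
  fixes k :: "'b::real_normed_vector \<Rightarrow> 'a::finite \<Rightarrow> 'a pmf"
  assumes pos: "\<And>\<theta> x y. 0 < pmf (k \<theta> x) y"
    and inv: "\<And>\<theta>. invariant (k \<theta>) (\<pi> \<theta>)"
    and deriv: "\<And>x y. ((\<lambda>\<theta>. pmf (k \<theta> x) y) has_derivative k' x y) (at \<theta>)"
  shows "((\<lambda>\<theta>. mean (\<pi> \<theta>) f) has_derivative
           (\<lambda>h. \<Sum>x\<in>UNIV. pmf (\<pi> \<theta>) x *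
                  (\<Sum>y\<in>UNIV. k' x y h * positive_kernel.poisson_solution (k \<theta>) (\<pi> \<theta>) f y))) (at \<theta>)"
proof -
  interpret positive_kernel "k \<theta>"
    by standard (rule pos)
  let ?F = "\<lambda>g x \<eta>. \<Sum>y\<in>UNIV. (pmf (k \<eta> x) y - pmf (k \<theta> x) y) * g y"
  have pert: "mean (\<pi> \<eta>) f = mean (\<pi> \<theta>) f
      + (\<Sum>x\<in>UNIV. pmf (\<pi> \<eta>) x * ?F (poisson_solution (\<pi> \<theta>) f) x \<eta>)" for \<eta> f
    using stationary_perturbation[OF inv[of \<theta>] inv[of \<eta>], of f] by linarith
  have F_deriv: "(?F g x has_derivative (\<lambda>h. \<Sum>y\<in>UNIV. k' x y h * g y)) (at \<theta>)" for g x
    by (auto intro!: derivative_eq_intros deriv)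
  have F_lim: "(?F g x \<longlongrightarrow> 0) (at \<theta>)" for x g
    using has_derivative_continuous[OF F_deriv[where g = g and x = x]] by (simp add: continuous_within)
  have cont: "((\<lambda>\<eta>. pmf (\<pi> \<eta>) z) \<longlongrightarrow> pmf (\<pi> \<theta>) z) (at \<theta>)" for z
  proof -
    let ?g = "poisson_solution (\<pi> \<theta>) (\<lambda>x. of_bool (x = z))"
    have "((\<lambda>\<eta>. \<Sum>x\<in>UNIV. pmf (\<pi> \<eta>) x * ?F ?g x \<eta>) \<longlongrightarrow> 0) (at \<theta>)"
    proof (rule tendsto_null_sum)
      fix x
      show "((\<lambda>\<eta>. pmf (\<pi> \<eta>) x * ?F ?g x \<eta>) \<longlongrightarrow> 0) (at \<theta>)"
      proof (rule Lim_null_comparison)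
        show "\<forall>\<^sub>F \<eta> in at \<theta>. norm (pmf (\<pi> \<eta>) x * ?F ?g x \<eta>) \<le> \<bar>?F ?g x \<eta>\<bar>"
          by (intro always_eventually allI) (simp add: abs_mult mult_left_le_one_le pmf_le_1)
        show "((\<lambda>\<eta>. \<bar>?F ?g x \<eta>\<bar>) \<longlongrightarrow> 0) (at \<theta>)"
          using tendsto_rabs_zero[OF F_lim] .
      qed
    qed
    moreover have diff: "pmf (\<pi> \<eta>) z - pmf (\<pi> \<theta>) z = (\<Sum>x\<in>UNIV. pmf (\<pi> \<eta>) x * ?F ?g x \<eta>)" for \<eta>
      using pert[of \<eta> "\<lambda>x. of_bool (x = z)"] unfolding mean_indicator by linarith
    ultimately have "((\<lambda>\<eta>. pmf (\<pi> \<eta>) z - pmf (\<pi> \<theta>) z) \<longlongrightarrow> 0) (at \<theta>)"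
      by (simp only: diff)
    then show ?thesis
      by (simp add: LIM_zero_iff)
  qed
  have prod: "((\<lambda>\<eta>. pmf (\<pi> \<eta>) x * ?F g x \<eta>) has_derivative
               (\<lambda>h. pmf (\<pi> \<theta>) x * (\<Sum>y\<in>UNIV. k' x y h * g y))) (at \<theta>)" for g x
    using has_derivative_mult_vanishing[OF F_deriv[where g = g and x = x], of "\<lambda>\<eta>. pmf (\<pi> \<eta>) x"] cont by simp
  have "((\<lambda>\<eta>. mean (\<pi> \<theta>) f + (\<Sum>x\<in>UNIV. pmf (\<pi> \<eta>) x * ?F (poisson_solution (\<pi> \<theta>) f) x \<eta>))
      has_derivative (\<lambda>h. 0 + (\<Sum>x\<in>UNIV. pmf (\<pi> \<theta>) x *
        (\<Sum>y\<in>UNIV. k' x y h * poisson_solution (\<pi> \<theta>) f y)))) (at \<theta>)"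
    by (intro has_derivative_add has_derivative_const has_derivative_sum prod)
  then show ?thesis
    by (simp only: pert[symmetric] add_0)
qed

section \<open>The transition kernel of the Little model\<close>

text \<open>
  The derivative at \<open>\<theta>\<close>, in direction \<open>h\<close>, of the logarithm of the transition probability from \<open>x\<close> to \<open>y\<close>.
  The potential is linear in the parameter, hence it is its own derivative.
\<close>

definition score :: "'n::finite param \<Rightarrow> 'n state \<Rightarrow> 'n state \<Rightarrow> 'n param \<Rightarrow> real" where
  "score \<theta> x y h = (\<Sum>i\<in>UNIV. (of_bool (y i) - sigma (potential \<theta> x i)) * potential h x i)"

lemma little_kernel_bernoulli:
  "little_kernel \<theta> x y = (\<Prod>i\<in>UNIV. pmf (bernoulli_pmf (sigma (potential \<theta> x i))) (y i))"
  unfolding little_kernel_conv_Pi_pmf by (subst pmf_Pi) auto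

lemma little_kernel_pos: "0 < little_kernel \<theta> x y"
  unfolding little_kernel_def
  by (intro prod_pos mult_pos_pos zero_less_power ballI) (simp_all add: sigma_pos sigma_less_1)

lemma positive_kernel_little_step: "positive_kernel (little_step \<theta>)"
  by standard (simp add: pmf_little_step little_kernel_pos)

lemma invariant_stationary_dist: "invariant (little_step \<theta>) (stationary_dist \<theta>)"
proof -
  have "stationary \<theta> = invariant (little_step \<theta>)"
    by (auto simp: fun_eq_iff stationary_def invariant_iff pmf_little_step)
  then show ?thesis
    unfolding stationary_dist_def
    using theI'[OF positive_kernel.ex1_invariant[OF positive_kernel_little_step, of \<theta>]] by simp
qed

lemma stationary_cost_eq_mean: "stationary_cost e \<theta> = mean (stationary_dist \<theta>) e"
  by (simp add: stationary_cost_def mean_def mult.commute)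

lemma mean_little_chain: "mean (little_chain \<theta> x t) f = (average (little_step \<theta>) ^^ t) f x"
proof -
  have "little_chain \<theta> x t = ((\<lambda>q. bind_pmf q (little_step \<theta>)) ^^ t) (return_pmf x)"
    by (induction t) auto
  then show ?thesis
    by (simp add: mean_chain)
qed

lemma linear_potential: "linear (\<lambda>h. potential h x i)"
  by (rule linearI) (auto simp: potential_def sum.distrib algebra_simps sum_distrib_left
      simp del: sum_of_bool_mult_eq sum_mult_of_bool_eq)

lemma has_derivative_potential:
  "((\<lambda>\<theta>. potential \<theta> x i) has_derivative (\<lambda>h. potential h x i)) F"
  using linear_potential by (intro bounded_linear_imp_has_derivative) (simp add: linear_conv_bounded_linear)

lemma has_field_derivative_sigma: "(sigma has_field_derivative sigma s * (1 - sigma s)) (at s)"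
proof -
  have "1 + exp (- s) > 0"
    by (simp add: add_pos_pos)
  then have "((\<lambda>s. 1 / (1 + exp (- s))) has_field_derivative exp (- s) / (1 + exp (- s))\<^sup>2) (at s)"
    by (auto intro!: derivative_eq_intros simp: power2_eq_square)
  moreover have "exp (- s) / (1 + exp (- s))\<^sup>2 = sigma s * (1 - sigma s)"
    using \<open>1 + exp (- s) > 0\<close> by (simp add: sigma_def field_simps power2_eq_square)
  ultimately show ?thesis
    by (simp add: sigma_def[abs_def])
qed

lemma has_derivative_little_kernel:
  "((\<lambda>\<theta>. little_kernel \<theta> x y) has_derivative (\<lambda>h. little_kernel \<theta> x y * score \<theta> x y h)) (at \<theta>)"
proof -
  define f where "f i \<theta> = pmf (bernoulli_pmf (sigma (potential \<theta> x i))) (y i)" for i \<theta>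
  have f_eq: "f i = (\<lambda>\<theta>. if y i then sigma (potential \<theta> x i) else 1 - sigma (potential \<theta> x i))" for i
    using sigma_pos sigma_less_1 by (auto simp: f_def less_imp_le)
  have sig: "((\<lambda>\<theta>. sigma (potential \<theta> x i)) has_derivative
      (\<lambda>h. sigma (potential \<theta> x i) * (1 - sigma (potential \<theta> x i)) * potential h x i)) (at \<theta>)" for i
    by (rule has_derivative_compose[OF has_derivative_potential
        has_field_derivative_sigma[unfolded has_field_derivative_def]])
  have "(f i has_derivative
      (\<lambda>h. f i \<theta> * ((of_bool (y i) - sigma (potential \<theta> x i)) * potential h x i))) (at \<theta>)" for i
  proof (cases "y i")
    case True
    then show ?thesis
      using sig[of i] by (simp add: f_eq mult.assoc)
  next
    case False
    then show ?thesis
      using has_derivative_diff[OF has_derivative_const[of 1] sig[of i]] by (simp add: f_eq algebra_simps)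
  qed
  then have "((\<lambda>\<theta>. \<Prod>i\<in>UNIV. f i \<theta>) has_derivative (\<lambda>h. \<Sum>i\<in>UNIV.
      f i \<theta> * ((of_bool (y i) - sigma (potential \<theta> x i)) * potential h x i) * (\<Prod>j\<in>UNIV - {i}. f j \<theta>))) (at \<theta>)"
    by (intro has_derivative_prod)
  moreover have "f i \<theta> * c * (\<Prod>j\<in>UNIV - {i}. f j \<theta>) = (\<Prod>j\<in>UNIV. f j \<theta>) * c" for i c
    by (subst prod.remove[of UNIV i]) auto
  moreover have "little_kernel \<eta> x y = (\<Prod>i\<in>UNIV. f i \<eta>)" for \<eta>
    by (simp add: little_kernel_bernoulli f_def)
  ultimately show ?thesis
    by (simp only: score_def sum_distrib_left)
qed

section \<open>The law of the sequential sampler\<close>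

text \<open>
  The expected value of the weight \<open>d + (\<Sum>i. a i * of_bool (z i))\<close> of a configuration \<open>z\<close> that agrees
  with \<open>x\<close> outside \<open>S\<close> and has independent Bernoulli values of parameters \<open>\<beta> i\<close> at the sites of \<open>S\<close>.
\<close>

definition pinned_weight ::
  "real \<Rightarrow> ('n::finite \<Rightarrow> real) \<Rightarrow> ('n \<Rightarrow> real) \<Rightarrow> 'n set \<Rightarrow> 'n state \<Rightarrow> real" where
  "pinned_weight d a \<beta> S x = d + (\<Sum>i\<in>- S. a i * of_bool (x i)) + (\<Sum>i\<in>S. \<beta> i * a i)"

text \<open>
  The law of total expectation, conditioning on the value at the site \<open>k\<close>.
\<close>

lemma pinned_weight_split:
  assumes "k \<in> S"
  shows "pinned_weight d a \<beta> S x
       = \<beta> k * pinned_weight d a \<beta> (S - {k}) (x(k := True))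
       + (1 - \<beta> k) * pinned_weight d a \<beta> (S - {k}) (x(k := False))"
proof -
  have 1: "- (S - {k}) = insert k (- S)"
    using assms by auto
  have "(\<Sum>i\<in>- S. a i * of_bool ((x(k := b)) i)) = (\<Sum>i\<in>- S. a i * of_bool (x i))" for b
    using assms by (intro sum.cong) auto
  moreover have "(\<Sum>i\<in>S. \<beta> i * a i) = \<beta> k * a k + (\<Sum>i\<in>S - {k}. \<beta> i * a i)"
    using assms by (simp add: sum.remove)
  ultimately show ?thesis
    using assms unfolding pinned_weight_def 1 by (subst (1 2) sum.insert) (auto simp: algebra_simps)
qed

text \<open>
  Bayes' rule under the weighted law: the prior probability of the value 1 at \<open>k\<close> is reweighted by the
  ratio of the expected weights after and before that value is revealed. At the first site nothing is
  pinned, and the expected weight is the normalising constant \<open>c\<close>.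
\<close>

lemma sampler_prob_eq:
  fixes k :: "'n::{finite,linorder}"
  assumes below: "\<And>i. i \<in> - insert k T \<longleftrightarrow> i < k" and above: "\<And>i. i \<in> T \<longleftrightarrow> k < i"
    and c: "c = pinned_weight d a \<beta> UNIV x"
  shows "sampler_prob c d a \<beta> k x
       = \<beta> k * pinned_weight d a \<beta> T (x(k := True)) / pinned_weight d a \<beta> (insert k T) x"
proof -
  have S1: "- insert k T = {..<k}" and S2: "T = {k<..}"
    using below above by blast+
  have S3: "insert k T = {k..}" and S4: "- T = insert k {..<k}"
    unfolding S2 by force+
  have "(\<Sum>i\<in>{..<k}. a i * of_bool ((x(k := True)) i)) = (\<Sum>i\<in>{..<k}. a i * of_bool (x i))"
    by (intro sum.cong) auto
  then have num: "pinned_weight d a \<beta> T (x(k := True))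
      = d + (\<Sum>i\<in>{..<k}. a i * of_bool (x i)) + a k + (\<Sum>i\<in>{k<..}. \<beta> i * a i)"
    unfolding pinned_weight_def S4 by (simp add: S2)
  have den: "pinned_weight d a \<beta> (insert k T) x
      = d + (\<Sum>i\<in>{..<k}. a i * of_bool (x i)) + (\<Sum>i\<in>{k..}. \<beta> i * a i)"
    unfolding pinned_weight_def S1 by (simp only: S3)
  show ?thesis
  proof (cases "k = Min UNIV")
    case True
    have "k \<le> i" for i
      unfolding True by (rule Min_le) auto
    then have "{..<k} = {}" "{k..} = UNIV"
      by (auto simp: not_le[symmetric] simp del: not_le)
    then show ?thesis
      unfolding num den sampler_prob_def c using True
      by (simp add: pinned_weight_def mult.commute add.assoc)
  next
    case False
    then show ?thesis
      unfolding num den sampler_prob_def by (simp add: mult.commute)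
  qed
qed

text \<open>
  The successive ratios of expected weights telescope. The equation is multiplied out because the weight
  of a complete configuration may be zero, for instance that of the all-zero one if \<open>d = 0\<close>; the sampler
  itself divides only by weights with at least one free site, which are positive.
\<close>

lemma pmf_sample_sites:
  fixes x y :: "'n::{finite,linorder} state"
  assumes \<beta>: "\<And>i. 0 < \<beta> i" "\<And>i. \<beta> i < 1"
    and nonneg: "\<And>S x. 0 \<le> pinned_weight d a \<beta> S x"
    and pos: "\<And>S x. S \<noteq> {} \<Longrightarrow> 0 < pinned_weight d a \<beta> S x"
    and c: "\<And>x. c = pinned_weight d a \<beta> UNIV x"
    and ks: "sorted ks" "distinct ks" "\<And>i j. i \<notin> set ks \<Longrightarrow> j \<in> set ks \<Longrightarrow> i < j"
  shows "pinned_weight d a \<beta> (set ks) x * pmf (sample_sites c d a \<beta> ks x) y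
       = of_bool (\<forall>i. i \<notin> set ks \<longrightarrow> y i = x i)
         * (\<Prod>i\<in>set ks. pmf (bernoulli_pmf (\<beta> i)) (y i)) * pinned_weight d a \<beta> {} y"
  using ks
proof (induction ks arbitrary: x)
  case Nil
  then show ?case
    by (auto simp: pmf_return indicator_def fun_eq_iff) (metis (full_types) ext)+
next
  case (Cons k ks)
  let ?W = "pinned_weight d a \<beta>" and ?S = "set (k # ks)"
  define p where "p = sampler_prob c d a \<beta> k x"
  have k: "k \<notin> set ks"
    using Cons.prems by auto
  have ks_iff: "i \<in> set ks \<longleftrightarrow> k < i" for i
  proof
    show "k < i" if "i \<in> set ks"
      using that Cons.prems(1) k by (auto simp: order_less_le)
    show "i \<in> set ks" if "k < i"
      using that Cons.prems(3)[of i k] by force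
  qed
  have below: "i \<in> - insert k (set ks) \<longleftrightarrow> i < k" for i
    using ks_iff[of i] by auto
  have split: "?W ?S x = \<beta> k * ?W (set ks) (x(k := True)) + (1 - \<beta> k) * ?W (set ks) (x(k := False))"
    using pinned_weight_split[of k ?S] k by simp
  have S: "0 < ?W ?S x"
    by (rule pos) simp
  have p_eq: "p = \<beta> k * ?W (set ks) (x(k := True)) / ?W ?S x"
    unfolding p_def using sampler_prob_eq[OF below ks_iff c] by simp
  then have W_True: "?W ?S x * p = \<beta> k * ?W (set ks) (x(k := True))"
    using S by simp
  then have W_False: "?W ?S x * (1 - p) = (1 - \<beta> k) * ?W (set ks) (x(k := False))"
    using split by (simp add: algebra_simps)
  have p: "0 \<le> p" "p \<le> 1"
    using S \<beta>[of k] nonneg[of "set ks"] split unfolding p_eq by (auto simp: divide_le_eq)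
  have IH: "?W (set ks) z * pmf (sample_sites c d a \<beta> ks z) y
       = of_bool (\<forall>i. i \<notin> set ks \<longrightarrow> y i = z i)
         * (\<Prod>i\<in>set ks. pmf (bernoulli_pmf (\<beta> i)) (y i)) * ?W {} y" for z
    using Cons.prems by (intro Cons.IH) (auto simp: ks_iff)
  \<comment> \<open>The remaining sites never overwrite \<open>k\<close>, so only the branch with the value \<open>y k\<close> contributes.\<close>
  have agree: "(\<forall>i. i \<notin> set ks \<longrightarrow> y i = (x(k := b)) i) \<longleftrightarrow> y k = b \<and> (\<forall>i. i \<notin> ?S \<longrightarrow> y i = x i)" for b
    using k by auto
  have "pmf (sample_sites c d a \<beta> (k # ks) x) y
      = pmf (sample_sites c d a \<beta> ks (x(k := True))) y * p
      + pmf (sample_sites c d a \<beta> ks (x(k := False))) y * (1 - p)"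
    using p by (simp add: pmf_bind p_def)
  then have "?W ?S x * pmf (sample_sites c d a \<beta> (k # ks) x) y
      = pmf (sample_sites c d a \<beta> ks (x(k := True))) y * (?W ?S x * p)
      + pmf (sample_sites c d a \<beta> ks (x(k := False))) y * (?W ?S x * (1 - p))"
    by (simp only: distrib_left mult_ac)
  also have "\<dots> = \<beta> k * (?W (set ks) (x(k := True)) * pmf (sample_sites c d a \<beta> ks (x(k := True))) y)
      + (1 - \<beta> k) * (?W (set ks) (x(k := False)) * pmf (sample_sites c d a \<beta> ks (x(k := False))) y)"
    unfolding W_True W_False by (simp only: mult_ac)
  also have "\<dots> = of_bool (\<forall>i. i \<notin> ?S \<longrightarrow> y i = x i)
      * (pmf (bernoulli_pmf (\<beta> k)) (y k) * (\<Prod>i\<in>set ks. pmf (bernoulli_pmf (\<beta> i)) (y i))) * ?W {} y"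
    unfolding IH agree using \<beta>[of k] by (cases "y k") auto
  finally show ?case
    using k by simp
qed

text \<open>
  The sampler draws from the product of Bernoulli laws, reweighted by an affine function of the
  configuration.
\<close>

lemma pmf_sequential_sampler:
  fixes y :: "'n::{finite,linorder} state"
  assumes "\<And>i. 0 < \<beta> i" "\<And>i. \<beta> i < 1"
    and "0 \<le> d" "\<And>i. 0 \<le> a i" "\<And>i. 0 < d + \<beta> i * a i"
    and c: "c = d + (\<Sum>i\<in>UNIV. \<beta> i * a i)"
  shows "c * pmf (sequential_sampler c d a \<beta>) y
       = (\<Prod>i\<in>UNIV. pmf (bernoulli_pmf (\<beta> i)) (y i)) * (d + (\<Sum>i\<in>UNIV. a i * of_bool (y i)))"
proof -
  have \<beta>: "0 \<le> \<beta> i" for i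
    using assms(1)[of i] by simp
  have nonneg: "0 \<le> pinned_weight d a \<beta> S x" for S x
    unfolding pinned_weight_def
    by (intro add_nonneg_nonneg sum_nonneg mult_nonneg_nonneg assms(3,4) \<beta>) simp
  have pos: "0 < pinned_weight d a \<beta> S x" if ne: "S \<noteq> {}" for S x
  proof -
    obtain k where k: "k \<in> S"
      using ne by blast
    have "\<beta> k * a k \<le> (\<Sum>i\<in>S. \<beta> i * a i)"
      using k by (intro member_le_sum mult_nonneg_nonneg assms(4) \<beta>) auto
    moreover have "0 \<le> (\<Sum>i\<in>- S. a i * of_bool (x i))"
      by (intro sum_nonneg mult_nonneg_nonneg assms(4)) simp
    ultimately show ?thesis
      unfolding pinned_weight_def using assms(5)[of k] by linarith
  qed
  have c': "c = pinned_weight d a \<beta> UNIV x" for x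
    by (simp add: pinned_weight_def c)
  show ?thesis
    using pmf_sample_sites[OF assms(1,2) nonneg pos c', of "sorted_list_of_set UNIV" "\<lambda>_. False" y]
    unfolding sequential_sampler_def c'[symmetric] by (simp add: pinned_weight_def c)
qed

lemma sigma_nonneg: "0 \<le> sigma s"
  using sigma_pos[of s] by simp

lemma data_d_eq: "data_d h \<theta> v x = (\<Sum>i\<in>UNIV. sigma (potential \<theta> x i) * data_a h v x i)"
  by (simp add: data_d_def data_a_def algebra_simps sum.distrib sum_distrib_left)

text \<open>
  Positivity of the expected weights comes from the biases: a nonzero \<open>snd v $ i\<close> contributes a positive
  amount either to \<open>data_a h v x i\<close> or, with the factor \<open>sigma (potential \<theta> x i)\<close>, to \<open>data_d h' \<theta> v x\<close>. The parts of a
  number add up to its absolute value, which makes \<open>c_weight\<close> the normalising constant.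
\<close>

lemma pmf_sampler:
  fixes y :: "'n::{finite,linorder} state"
  assumes h: "\<And>r. 0 \<le> h r" "\<And>r. 0 \<le> h' r" "\<And>r. h r + h' r = \<bar>r\<bar>"
    and v: "\<And>i. snd v $ i \<noteq> 0"
  shows "c_weight \<theta> v x * pmf (sequential_sampler (c_weight \<theta> v x) (data_d h' \<theta> v x) (data_a h v x)
            (\<lambda>i. sigma (potential \<theta> x i))) y
       = little_kernel \<theta> x y * (data_d h' \<theta> v x + (\<Sum>i\<in>UNIV. data_a h v x i * of_bool (y i)))"
  unfolding little_kernel_bernoulli
proof (rule pmf_sequential_sampler)
  let ?s = "\<lambda>i. sigma (potential \<theta> x i)"
  have a: "h (snd v $ i) \<le> data_a h v x i" "h' (snd v $ i) \<le> data_a h' v x i" for i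
    using h by (auto simp: data_a_def intro!: sum_nonneg)
  show a0: "0 \<le> data_a h v x i" for i
    using a(1)[of i] h(1) by (rule order_trans[rotated])
  have a0': "0 \<le> data_a h' v x i" for i
    using a(2)[of i] h(2) by (rule order_trans[rotated])
  show "0 \<le> data_d h' \<theta> v x"
    unfolding data_d_eq by (intro sum_nonneg mult_nonneg_nonneg a0' sigma_nonneg)
  show "0 < data_d h' \<theta> v x + ?s i * data_a h v x i" for i
  proof -
    have "0 < ?s i * \<bar>snd v $ i\<bar>"
      using v sigma_pos by simp
    also have "\<dots> = ?s i * h' (snd v $ i) + ?s i * h (snd v $ i)"
      by (simp add: h(3)[symmetric] algebra_simps)
    also have "\<dots> \<le> ?s i * data_a h' v x i + ?s i * data_a h v x i"
      by (intro add_mono mult_left_mono a sigma_nonneg)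
    also have "?s i * data_a h' v x i \<le> data_d h' \<theta> v x"
      unfolding data_d_eq by (intro member_le_sum mult_nonneg_nonneg a0' sigma_nonneg) auto
    finally show ?thesis
      by simp
  qed
  have "data_a h v x i + data_a h' v x i = \<bar>snd v $ i\<bar> + (\<Sum>j\<in>UNIV. \<bar>fst v $ i $ j\<bar> * of_bool (x j))" for i
    by (simp add: data_a_def h(3)[symmetric] sum.distrib algebra_simps)
  then have "c_weight \<theta> v x = (\<Sum>i\<in>UNIV. ?s i * (data_a h v x i + data_a h' v x i))"
    by (simp add: c_weight_def sum.distrib algebra_simps sum_distrib_left)
  then show "c_weight \<theta> v x = data_d h' \<theta> v x + (\<Sum>i\<in>UNIV. ?s i * data_a h v x i)"
    by (simp add: data_d_eq sum.distrib algebra_simps)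
qed (auto simp: sigma_pos sigma_less_1)

text \<open>
  The two samplers represent the directional derivative of the transition kernel as a multiple of a
  difference of two probability laws. Indeed the affine weights differ by
  \<open>(\<Sum>i. (of_bool (y i) - sigma (potential \<theta> x i)) * (data_a pos_part v x i - data_a neg_part v x i))\<close>, and the
  last factor is the potential of \<open>v\<close>.
\<close>

lemma sampler_difference:
  assumes "\<And>i. snd v $ i \<noteq> 0"
  shows "c_weight \<theta> v x * (pmf (sampler_plus \<theta> v x) y - pmf (sampler_minus \<theta> v x) y)
       = little_kernel \<theta> x y * score \<theta> x y v"
proof -
  have "data_a pos_part v x i - data_a neg_part v x i = potential v x i" for i
  proof -
    have parts: "pos_part r = r + neg_part r" for r
      by (simp add: pos_part_def neg_part_def max_def)
    show ?thesis
      by (simp add: data_a_def potential_def parts sum.distrib algebra_simps)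
  qed
  then have score: "score \<theta> x y v = (data_d neg_part \<theta> v x + (\<Sum>i\<in>UNIV. data_a pos_part v x i * of_bool (y i)))
      - (data_d pos_part \<theta> v x + (\<Sum>i\<in>UNIV. data_a neg_part v x i * of_bool (y i)))"
    unfolding score_def data_d_eq
    by (simp flip: sum.distrib sum_subtractf add: algebra_simps del: sum_of_bool_mult_eq sum_mult_of_bool_eq)
  have "c_weight \<theta> v x * pmf (sampler_plus \<theta> v x) y
      = little_kernel \<theta> x y * (data_d neg_part \<theta> v x + (\<Sum>i\<in>UNIV. data_a pos_part v x i * of_bool (y i)))"
    unfolding sampler_plus_def
    by (rule pmf_sampler) (use assms in \<open>auto simp: pos_part_def neg_part_def\<close>)
  moreover have "c_weight \<theta> v x * pmf (sampler_minus \<theta> v x) y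
      = little_kernel \<theta> x y * (data_d pos_part \<theta> v x + (\<Sum>i\<in>UNIV. data_a neg_part v x i * of_bool (y i)))"
    unfolding sampler_minus_def
    by (rule pmf_sampler) (use assms in \<open>auto simp: pos_part_def neg_part_def\<close>)
  ultimately show ?thesis
    unfolding score by (simp only: right_diff_distrib)
qed

section \<open>The law of the noise-driven trajectories\<close>

text \<open>
  The noise-driven update uses a strict inequality; it has the right law because the logistic
  distribution has no atoms.
\<close>

lemma measure_logistic_lessThan: "measure logistic_distribution {..<u} = sigma u"
proof -
  interpret real_distribution logistic_distribution
    by (rule real_distribution_logistic)
  have "isCont sigma u"
    using has_field_derivative_sigma by (rule DERIV_isCont)
  then have "measure logistic_distribution {u} = 0"
    by (simp add: isCont_cdf[symmetric] cdf_logistic)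
  moreover have "measure logistic_distribution {..u} = measure logistic_distribution {..<u} + measure logistic_distribution {u}"
    by (subst finite_measure_Union[symmetric]) (auto intro!: arg_cong[where f = "measure _"])
  ultimately show ?thesis
    using cdf_logistic by (simp add: cdf_def fun_eq_iff)
qed

lemma
  fixes x :: "'n::finite state"
  shows measurable_little_map:
      "little_map \<theta> x \<in> (\<Pi>\<^sub>M i\<in>UNIV. logistic_distribution) \<rightarrow>\<^sub>M count_space UNIV"
    and distr_little_map:
      "distr (\<Pi>\<^sub>M i\<in>UNIV. logistic_distribution) (count_space UNIV) (little_map \<theta> x)
         = measure_pmf (little_step \<theta> x)"
proof -
  interpret L: real_distribution logistic_distribution
    by (rule real_distribution_logistic)
  interpret N: product_prob_space "\<lambda>_::'n. logistic_distribution" UNIV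
    by unfold_locales
  define B where "B y i = (if y i then {..<potential \<theta> x i} else {potential \<theta> x i..})" for y i
  have B: "B y i \<in> sets logistic_distribution" for y i
    by (simp add: B_def)
  have preimage: "little_map \<theta> x -` {y} \<inter> space (\<Pi>\<^sub>M i\<in>UNIV. logistic_distribution)
      = {\<xi> \<in> space (\<Pi>\<^sub>M i\<in>UNIV. logistic_distribution). \<forall>i\<in>UNIV. \<xi> i \<in> B y i}" for y
  proof -
    have "little_map \<theta> x \<xi> i = y i \<longleftrightarrow> \<xi> i \<in> B y i" for \<xi> i
      by (cases "y i") (auto simp: little_map_def B_def)
    then have "little_map \<theta> x \<xi> = y \<longleftrightarrow> (\<forall>i. \<xi> i \<in> B y i)" for \<xi>
      by (simp only: fun_eq_iff)
    then show ?thesis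
      by auto
  qed
  have preimage_PiE: "{\<xi> \<in> space (\<Pi>\<^sub>M i\<in>UNIV. logistic_distribution). \<forall>i\<in>UNIV. \<xi> i \<in> B y i}
      = Pi\<^sub>E UNIV (B y)" for y
    by (auto simp: space_PiM PiE_iff)
  show meas: "little_map \<theta> x \<in> (\<Pi>\<^sub>M i\<in>UNIV. logistic_distribution) \<rightarrow>\<^sub>M count_space UNIV"
  proof (subst measurable_count_space_eq2_countable, safe)
    show "little_map \<theta> x -` {y} \<inter> space (\<Pi>\<^sub>M i\<in>UNIV. logistic_distribution)
        \<in> sets (\<Pi>\<^sub>M i\<in>UNIV. logistic_distribution)" for y
      unfolding preimage preimage_PiE by (rule sets_PiM_I_finite) (simp_all only: finite B)
  qed auto
  have prob_B: "measure logistic_distribution (B y i)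
      = pmf (bernoulli_pmf (sigma (potential \<theta> x i))) (y i)" for y i
  proof (cases "y i")
    case True
    then show ?thesis
      using sigma_pos[of "potential \<theta> x i"] sigma_less_1[of "potential \<theta> x i"]
      by (simp add: B_def measure_logistic_lessThan)
  next
    case False
    have "{..<potential \<theta> x i} \<in> sets logistic_distribution"
      by simp
    moreover have "{potential \<theta> x i..} = space logistic_distribution - {..<potential \<theta> x i}"
      by auto
    ultimately have "measure logistic_distribution {potential \<theta> x i..} = 1 - sigma (potential \<theta> x i)"
      by (simp only: L.prob_compl measure_logistic_lessThan)
    then show ?thesis
      using False sigma_pos[of "potential \<theta> x i"] sigma_less_1[of "potential \<theta> x i"]
      by (simp add: B_def)
  qed
  show "distr (\<Pi>\<^sub>M i\<in>UNIV. logistic_distribution) (count_space UNIV) (little_map \<theta> x)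
      = measure_pmf (little_step \<theta> x)"
  proof (rule measure_eqI_finite[where A = UNIV])
    fix y
    have "emeasure (distr (\<Pi>\<^sub>M i\<in>UNIV. logistic_distribution) (count_space UNIV) (little_map \<theta> x)) {y}
        = (\<Prod>i\<in>UNIV. emeasure logistic_distribution (B y i))"
      by (subst emeasure_distr[OF meas]) (simp, simp only: preimage N.emeasure_PiM_Collect[OF subset_refl finite B])
    also have "\<dots> = ennreal (\<Prod>i\<in>UNIV. pmf (bernoulli_pmf (sigma (potential \<theta> x i))) (y i))"
      by (simp add: L.emeasure_eq_measure prob_B prod_ennreal)
    also have "\<dots> = emeasure (measure_pmf (little_step \<theta> x)) {y}"
      by (simp add: emeasure_pmf_single pmf_little_step little_kernel_bernoulli)
    finally show "emeasure (distr (\<Pi>\<^sub>M i\<in>UNIV. logistic_distribution) (count_space UNIV) (little_map \<theta> x)) {y}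
        = emeasure (measure_pmf (little_step \<theta> x)) {y}" .
  qed auto
qed

lemma integral_little_map:
  "(\<integral>\<xi>. f (little_map \<theta> x \<xi>) \<partial>(\<Pi>\<^sub>M i\<in>UNIV. logistic_distribution)) = average (little_step \<theta>) f x"
proof -
  have "(\<integral>\<xi>. f (little_map \<theta> x \<xi>) \<partial>(\<Pi>\<^sub>M i\<in>UNIV. logistic_distribution))
      = measure_pmf.expectation (little_step \<theta> x) f"
    unfolding distr_little_map[symmetric] by (rule integral_distr[symmetric]) (auto simp: measurable_little_map)
  then show ?thesis
    by (simp add: expectation_eq_mean average_def)
qed

lemma sequence_space_noise:
  "sequence_space (\<Pi>\<^sub>M i\<in>(UNIV :: 'n::finite set). logistic_distribution)"
proof -
  interpret L: real_distribution logistic_distribution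
    by (rule real_distribution_logistic)
  interpret N: product_prob_space "\<lambda>_::'n. logistic_distribution" UNIV
    by unfold_locales
  show ?thesis
    by unfold_locales
qed

lemma prob_space_noise_law: "prob_space (noise_law :: (nat \<Rightarrow> 'n::finite \<Rightarrow> real) measure)"
proof -
  interpret sequence_space "\<Pi>\<^sub>M i\<in>(UNIV :: 'n set). logistic_distribution"
    by (rule sequence_space_noise)
  show ?thesis
    unfolding noise_law_def by unfold_locales
qed

lemma measurable_trajectory:
  fixes x :: "'n::finite state"
  shows "(\<lambda>\<xi>. trajectory \<theta> \<xi> x t) \<in> noise_law \<rightarrow>\<^sub>M count_space UNIV"
proof (induction t)
  case (Suc t)
  have "(\<lambda>\<xi>. \<xi> (Suc t)) \<in> noise_law \<rightarrow>\<^sub>M (\<Pi>\<^sub>M i\<in>(UNIV :: 'n set). logistic_distribution)"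
    unfolding noise_law_def by (rule measurable_component_singleton) simp
  then have "(\<lambda>\<xi>. little_map \<theta> y (\<xi> (Suc t))) \<in> noise_law \<rightarrow>\<^sub>M count_space UNIV" for y :: "'n state"
    by (rule measurable_compose[OF _ measurable_little_map])
  then show ?case
    unfolding trajectory.simps by (rule measurable_compose_countable[OF _ Suc.IH])
qed simp

lemma trajectory_cong:
  "(\<And>s. s \<le> t \<Longrightarrow> \<xi> s = \<xi>' s) \<Longrightarrow> trajectory \<theta> \<xi> x t = trajectory \<theta> \<xi>' x t"
  by (induction t) auto

lemma measurable_of_trajectory:
  fixes f :: "'n::finite state \<Rightarrow> real"
  shows "(\<lambda>\<xi>. f (trajectory \<theta> \<xi> x t)) \<in> borel_measurable noise_law"
  by (rule measurable_compose[OF measurable_trajectory]) simp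

lemma integrable_trajectory:
  fixes f :: "'n::finite state \<Rightarrow> real"
  shows "integrable noise_law (\<lambda>\<xi>. f (trajectory \<theta> \<xi> x t))"
proof -
  interpret prob_space "noise_law :: (nat \<Rightarrow> 'n \<Rightarrow> real) measure"
    by (rule prob_space_noise_law)
  show ?thesis
    by (rule integrable_const_bound[where B = "Max (range (\<lambda>x. \<bar>f x\<bar>))"])
       (auto intro!: measurable_of_trajectory Max_ge)
qed

text \<open>
  Splicing two independent noise sequences after time \<open>t\<close> gives a sequence with the same law. The first
  one then determines the state at time \<open>t\<close>, and the second one independently drives the next step.
\<close>

lemma integral_trajectory:
  fixes f :: "'n::finite state \<Rightarrow> real"
  shows "(\<integral>\<xi>. f (trajectory \<theta> \<xi> x t) \<partial>noise_law) = (average (little_step \<theta>) ^^ t) f x"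
proof (induction t arbitrary: f)
  case 0
  interpret prob_space "noise_law :: (nat \<Rightarrow> 'n \<Rightarrow> real) measure"
    by (rule prob_space_noise_law)
  show ?case
    by (simp add: prob_space)
next
  case (Suc t)
  let ?S = "noise_law :: (nat \<Rightarrow> 'n \<Rightarrow> real) measure"
  let ?N = "\<Pi>\<^sub>M i\<in>(UNIV :: 'n set). logistic_distribution"
  interpret sequence_space ?N
    by (rule sequence_space_noise)
  interpret S: prob_space ?S
    by (rule prob_space_noise_law)
  interpret SS: pair_prob_space ?S ?S ..
  let ?f = "\<lambda>\<omega>. f (trajectory \<theta> \<omega> x (Suc t))"
  let ?g = "\<lambda>(\<omega>, \<omega>'). f (little_map \<theta> (trajectory \<theta> \<omega> x t) (\<omega>' 0))"
  \<comment> \<open>Times \<open>0, \<dots>, t\<close> come from the first sequence, and the noise at time \<open>Suc t\<close> is entry 0 of the second.\<close>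
  have comb: "distr (?S \<Otimes>\<^sub>M ?S) ?S (\<lambda>(\<omega>, \<omega>'). comb_seq (Suc t) \<omega> \<omega>') = ?S"
    using PiM_comb_seq[of "Suc t"] unfolding noise_law_def .
  have comb_meas: "(\<lambda>(\<omega>, \<omega>'). comb_seq (Suc t) \<omega> \<omega>') \<in> ?S \<Otimes>\<^sub>M ?S \<rightarrow>\<^sub>M ?S"
    unfolding noise_law_def by (rule measurable_comb_seq)
  have g: "?f (case p of (\<omega>, \<omega>') \<Rightarrow> comb_seq (Suc t) \<omega> \<omega>') = ?g p" for p
  proof (cases p)
    case (Pair \<omega> \<omega>')
    then show ?thesis
      using trajectory_cong[of t "comb_seq (Suc t) \<omega> \<omega>'" \<omega>] by (simp add: comb_seq_def)
  qed
  have meas: "?g \<in> borel_measurable (?S \<Otimes>\<^sub>M ?S)"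
    using measurable_compose[OF comb_meas measurable_of_trajectory[of f \<theta> x "Suc t"]]
    by (simp only: g)
  have int: "integrable (?S \<Otimes>\<^sub>M ?S) ?g"
    by (rule SS.integrable_const_bound[where B = "Max (range (\<lambda>x. \<bar>f x\<bar>))"])
       (auto intro!: meas Max_ge)
  have "(\<integral>\<omega>. ?f \<omega> \<partial>?S) = (\<integral>\<omega>. ?f \<omega> \<partial>distr (?S \<Otimes>\<^sub>M ?S) ?S (\<lambda>(\<omega>, \<omega>'). comb_seq (Suc t) \<omega> \<omega>'))"
    by (simp only: comb)
  also have "\<dots> = (\<integral>\<omega>. ?g \<omega> \<partial>(?S \<Otimes>\<^sub>M ?S))"
    by (subst integral_distr[OF comb_meas measurable_of_trajectory])
       (simp only: g)
  also have "\<dots> = (\<integral>\<omega>. \<integral>\<omega>'. ?g (\<omega>, \<omega>') \<partial>?S \<partial>?S)"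
    using SS.integral_fst'[OF int] by simp
  also have "\<dots> = (\<integral>\<omega>. average (little_step \<theta>) f (trajectory \<theta> \<omega> x t) \<partial>?S)"
  proof (rule Bochner_Integration.integral_cong[OF refl])
    fix \<omega> :: "nat \<Rightarrow> 'n \<Rightarrow> real"
    have "(\<integral>\<omega>'. ?g (\<omega>, \<omega>') \<partial>?S)
        = (\<integral>\<xi>. f (little_map \<theta> (trajectory \<theta> \<omega> x t) \<xi>) \<partial>distr ?S ?N (\<lambda>\<omega>'. \<omega>' 0))"
      unfolding noise_law_def
      by (subst integral_distr)
         (auto intro!: measurable_component_singleton measurable_compose[OF measurable_little_map])
    also have "distr ?S ?N (\<lambda>\<omega>'. \<omega>' 0) = ?N"
      unfolding noise_law_def by (rule PiM_component) simp
    finally show "(\<integral>\<omega>'. ?g (\<omega>, \<omega>') \<partial>?S) = average (little_step \<theta>) f (trajectory \<theta> \<omega> x t)"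
      by (simp only: integral_little_map)
  qed
  finally show ?case
    by (simp add: Suc.IH) (simp flip: funpow_swap1)
qed

section \<open>Random sign directions\<close>

text \<open>
  The constants \<open>\<alpha>\<close> and \<open>\<beta>\<close> absorb the sites whose signs are already fixed in the induction. They also allow the signs of
  the weights to be held fixed while the expectation over the signs of the biases is taken.
\<close>

lemma expectation_sign_products:
  fixes a b :: "'i \<Rightarrow> real"
  assumes "finite A"
  shows "measure_pmf.expectation (Pi_pmf A 0 (\<lambda>_. pmf_of_set {-1, 1 :: real}))
           (\<lambda>s. (\<alpha> + (\<Sum>i\<in>A. s i * a i)) * (\<beta> + (\<Sum>i\<in>A. s i * b i)))
       = \<alpha> * \<beta> + (\<Sum>i\<in>A. a i * b i)"
  using assms
proof (induction A arbitrary: \<alpha> \<beta>)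
  case empty
  show ?case
    by simp
next
  case (insert k A)
  let ?P = "Pi_pmf A 0 (\<lambda>_. pmf_of_set {-1, 1 :: real})"
  have sum: "(\<Sum>i\<in>insert k A. (s(k := y)) i * a i) = y * a k + (\<Sum>i\<in>A. s i * a i)" for s y a
  proof -
    have "(\<Sum>i\<in>A. (s(k := y)) i * a i) = (\<Sum>i\<in>A. s i * a i)"
      using insert.hyps by (intro sum.cong) auto
    then show ?thesis
      by (simp only: sum.insert[OF insert.hyps] fun_upd_same)
  qed
  have fin: "finite (set_pmf (bind_pmf ?P (\<lambda>s. return_pmf (s(k := y)))))" for y
    using insert.hyps by (auto simp: set_Pi_pmf)
  have coin: "measure_pmf.expectation (bind_pmf (pmf_of_set {-1, 1 :: real}) f) h
      = (measure_pmf.expectation (f (-1)) h + measure_pmf.expectation (f 1) h) / 2"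
    if "\<And>y. finite (set_pmf (f y))" for f and h :: "('i \<Rightarrow> real) \<Rightarrow> real"
    using that by (simp add: pmf_expectation_bind_pmf_of_set add_divide_distrib)
  have *: "measure_pmf.expectation (bind_pmf ?P (\<lambda>s. return_pmf (s(k := y))))
           (\<lambda>s. (\<alpha> + (\<Sum>i\<in>insert k A. s i * a i)) * (\<beta> + (\<Sum>i\<in>insert k A. s i * b i)))
       = (\<alpha> + y * a k) * (\<beta> + y * b k) + (\<Sum>i\<in>A. a i * b i)" for y
    unfolding map_pmf_def[symmetric] integral_map_pmf sum
    using insert.IH[of "\<alpha> + y * a k" "\<beta> + y * b k"] by (simp add: add.assoc)
  show ?case
    unfolding Pi_pmf_insert'[OF insert.hyps] coin[OF fin] *
    by (simp add: insert.hyps field_simps)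
qed

lemma set_pmf_Pi_sign:
  assumes "finite A" "s \<in> set_pmf (Pi_pmf A 0 (\<lambda>_. pmf_of_set {-1, 1 :: real}))" "i \<in> A"
  shows "s i \<noteq> 0"
proof -
  have "s i \<in> set_pmf (pmf_of_set {-1, 1})"
    using assms(2,3) unfolding set_Pi_pmf[OF assms(1)] PiE_dflt_def o_def by blast
  then show ?thesis
    by (subst (asm) set_pmf_of_set) auto
qed

lemma finite_set_pmf_Pi_sign:
  "finite A \<Longrightarrow> finite (set_pmf (Pi_pmf A 0 (\<lambda>_. pmf_of_set {-1, 1 :: real})))"
  unfolding set_Pi_pmf o_def by (rule finite_PiE_dflt) simp_all

lemma finite_set_pmf_direction_law: "finite (set_pmf (direction_law :: 'n::finite param pmf))"
  unfolding direction_law_def set_bind_pmf set_return_pmf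
  by (rule finite_UN_I[OF finite_set_pmf_Pi_sign[OF finite]],
      rule finite_UN_I[OF finite_set_pmf_Pi_sign[OF finite]]) (rule finite.insertI[OF finite.emptyI])

lemma direction_law_bias_nonzero:
  assumes "v \<in> set_pmf direction_law"
  shows "snd v $ i \<noteq> 0"
proof -
  obtain vw vb where "v = ((\<chi> i j. vw (i, j)), (\<chi> i. vb i))"
    and "vb \<in> set_pmf (Pi_pmf UNIV 0 (\<lambda>_. pmf_of_set {-1, 1 :: real}))"
    using assms unfolding direction_law_def set_bind_pmf set_return_pmf by blast
  then show ?thesis
    using set_pmf_Pi_sign[of UNIV vb i] by simp
qed

lemma expectation_direction_inner:
  fixes g h :: "'n::finite param"
  shows "measure_pmf.expectation direction_law (\<lambda>v. inner v g * inner v h) = inner g h"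
proof -
  let ?W = "Pi_pmf (UNIV :: ('n \<times> 'n) set) 0 (\<lambda>_. pmf_of_set {-1, 1 :: real})"
  let ?B = "Pi_pmf (UNIV :: 'n set) 0 (\<lambda>_. pmf_of_set {-1, 1 :: real})"
  define gw hw where "gw = (\<lambda>(i, j). fst g $ i $ j)" and "hw = (\<lambda>(i, j). fst h $ i $ j)"
  have inner: "inner (((\<chi> i j. vw (i, j)), (\<chi> i. vb i)) :: 'n param) g
      = (\<Sum>p\<in>UNIV. vw p * (\<lambda>(i, j). fst g $ i $ j) p) + (\<Sum>i\<in>UNIV. vb i * snd g $ i)"
    for vw vb and g :: "'n param"
    by (simp add: inner_prod_def inner_vec_def sum.cartesian_product' case_prod_beta' flip: UNIV_Times_UNIV)
  have "measure_pmf.expectation direction_law (\<lambda>v. inner v g * inner v h)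
      = (\<Sum>vw\<in>set_pmf ?W. pmf ?W vw *\<^sub>R measure_pmf.expectation ?B (\<lambda>vb.
          ((\<Sum>p\<in>UNIV. vw p * gw p) + (\<Sum>i\<in>UNIV. vb i * snd g $ i))
          * ((\<Sum>p\<in>UNIV. vw p * hw p) + (\<Sum>i\<in>UNIV. vb i * snd h $ i))))"
    unfolding direction_law_def gw_def hw_def map_pmf_def[symmetric] inner[symmetric]
    by (subst pmf_expectation_bind[where A = "set_pmf ?W"]) (auto simp: finite_set_pmf_Pi_sign)
  also have "\<dots> = measure_pmf.expectation ?W (\<lambda>vw.
      (\<Sum>p\<in>UNIV. vw p * gw p) * (\<Sum>p\<in>UNIV. vw p * hw p) + (\<Sum>i\<in>UNIV. snd g $ i * snd h $ i))"
    unfolding expectation_sign_products[OF finite]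
    by (rule integral_measure_pmf[symmetric]) (auto simp: finite_set_pmf_Pi_sign)
  also have "\<dots> = (\<Sum>p\<in>UNIV. gw p * hw p) + (\<Sum>i\<in>UNIV. snd g $ i * snd h $ i)"
    using expectation_sign_products[of UNIV 0 gw 0 hw]
    by (subst Bochner_Integration.integral_add)
       (auto intro!: integrable_measure_pmf_finite finite_set_pmf_Pi_sign)
  also have "\<dots> = inner g h"
    by (simp add: gw_def hw_def inner_prod_def inner_vec_def sum.cartesian_product' case_prod_beta' flip: UNIV_Times_UNIV)
  finally show ?thesis .
qed

text \<open>
  The entries of a random direction are uncorrelated with unit variance. Hence averaging \<open>v\<close> times the
  directional derivative along \<open>v\<close> returns the gradient.
\<close>

lemma average_over_directions:
  fixes g :: "'n::finite param"
  shows "(\<Sum>v\<in>set_pmf direction_law. pmf direction_law v *\<^sub>R (inner v g *\<^sub>R v)) = g"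
proof -
  have "inner (\<Sum>v\<in>set_pmf direction_law. pmf direction_law v *\<^sub>R (inner v g *\<^sub>R v)) h = inner g h" for h
  proof -
    have "measure_pmf.expectation direction_law (\<lambda>v. inner v g * inner v h)
        = (\<Sum>v\<in>set_pmf direction_law. pmf direction_law v *\<^sub>R (inner v g * inner v h))"
      by (rule integral_measure_pmf[OF finite_set_pmf_direction_law])
    then show ?thesis
      by (simp only: expectation_direction_inner inner_sum_left inner_scaleR_left real_scaleR_def)
  qed
  then show ?thesis
    by (rule vector_eq_rdot[THEN iffD1, OF allI])
qed

section \<open>The expectation of the estimator\<close>

text \<open>
  Fubini's theorem, with the integrability supplied by the finite support of \<open>p\<close>.
\<close>

lemma integral_pmf_pair:
  fixes F :: "'a \<times> 'b \<Rightarrow> 'c::{banach, second_countable_topology}"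
  assumes p: "finite (set_pmf p)" and N: "prob_space N"
    and meas: "F \<in> borel_measurable (measure_pmf p \<Otimes>\<^sub>M N)"
    and int: "\<And>s. integrable N (\<lambda>\<omega>. F (s, \<omega>))"
  shows "(\<integral>\<omega>. F \<omega> \<partial>(measure_pmf p \<Otimes>\<^sub>M N)) = measure_pmf.expectation p (\<lambda>s. \<integral>\<omega>. F (s, \<omega>) \<partial>N)"
proof -
  interpret N: prob_space N
    by (rule N)
  interpret pair_prob_space "measure_pmf p" N ..
  show ?thesis
    by (rule integral_fst'[symmetric], rule Fubini_integrable)
       (auto intro: meas int integrable_measure_pmf_finite p)
qed

lemma expectation_run_law:
  fixes \<theta> :: "'n::{finite,linorder} param"
  shows "(\<integral>\<omega>. mvd_delta e \<theta> M1 \<omega> *\<^sub>R direction \<omega> \<partial>run_law \<theta> K x M0)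
       = measure_pmf.expectation (start_law \<theta> K x M0) (\<lambda>(v, x0, xp, xm).
           (c_weight \<theta> v x0 * (\<Sum>t=0..M1. (average (little_step \<theta>) ^^ t) e xp
                                         - (average (little_step \<theta>) ^^ t) e xm)) *\<^sub>R v)"
proof -
  let ?S = "start_law \<theta> K x M0"
  let ?F = "\<lambda>\<omega>. mvd_delta e \<theta> M1 \<omega> *\<^sub>R direction \<omega>"
  have "finite (set_pmf ?S)"
    unfolding start_law_def set_bind_pmf
    by (intro finite_UN_I finite_set_pmf_direction_law) (auto split: prod.splits)
  moreover have "?F \<in> borel_measurable (measure_pmf ?S \<Otimes>\<^sub>M noise_law)"
  proof -
    \<comment> \<open>Every function of the start data is measurable. This does not suffice for the trajectories, which
      depend on the noise as well, but their initial states range over a finite type.\<close>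
    have fst: "(\<lambda>\<omega>. f (fst \<omega>)) \<in> measure_pmf ?S \<Otimes>\<^sub>M noise_law \<rightarrow>\<^sub>M N"
      if "range f \<subseteq> space N" for f and N :: "'c measure"
      using that by (intro measurable_compose[OF measurable_fst]) auto
    have traj: "(\<lambda>\<omega>. e (trajectory \<theta> (snd \<omega>) (y (fst \<omega>)) t)) \<in> borel_measurable (measure_pmf ?S \<Otimes>\<^sub>M noise_law)"
      for y t
      by (rule measurable_compose_countable[where f = "\<lambda>y \<omega>. e (trajectory \<theta> (snd \<omega>) y t)"])
         (auto intro!: fst measurable_compose[OF measurable_snd measurable_of_trajectory])
    have "?F = (\<lambda>\<omega>. (c_weight \<theta> (fst (fst \<omega>)) (fst (snd (fst \<omega>)))
        * (\<Sum>t=0..M1. e (trajectory \<theta> (snd \<omega>) (fst (snd (snd (fst \<omega>)))) t)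
                   - e (trajectory \<theta> (snd \<omega>) (snd (snd (snd (fst \<omega>)))) t))) *\<^sub>R fst (fst \<omega>))"
      by (auto simp: fun_eq_iff mvd_delta_def direction_def)
    also have "\<dots> \<in> borel_measurable (measure_pmf ?S \<Otimes>\<^sub>M noise_law)"
      by (intro borel_measurable_scaleR borel_measurable_times borel_measurable_sum borel_measurable_diff
          fst[of "\<lambda>s. c_weight \<theta> (fst s) (fst (snd s))"] fst[of fst]
          traj[of "\<lambda>s. fst (snd (snd s))"] traj[of "\<lambda>s. snd (snd (snd s))"]) auto
    finally show ?thesis .
  qed
  moreover have "integrable noise_law (\<lambda>\<xi>. ?F (s, \<xi>))" for s
  proof -
    obtain v x0 xp xm where "s = (v, x0, xp, xm)"
      by (rule prod_cases4)
    then show ?thesis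
      by (simp only: mvd_delta_def direction_def prod.case fst_conv)
         (intro integrable_scaleR_left integrable_mult_right Bochner_Integration.integrable_sum
           Bochner_Integration.integrable_diff integrable_trajectory)
  qed
  moreover have "(\<integral>\<xi>. ?F (s, \<xi>) \<partial>noise_law) = (case s of (v, x0, xp, xm) \<Rightarrow>
      (c_weight \<theta> v x0 * (\<Sum>t=0..M1. (average (little_step \<theta>) ^^ t) e xp
                                    - (average (little_step \<theta>) ^^ t) e xm)) *\<^sub>R v)" for s
  proof -
    obtain v x0 xp xm where "s = (v, x0, xp, xm)"
      by (rule prod_cases4)
    then show ?thesis
      by (simp add: mvd_delta_def direction_def integrable_trajectory integral_trajectory)
  qed
  ultimately show ?thesis
    unfolding run_law_def by (simp add: integral_pmf_pair prob_space_noise_law)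
qed

text \<open>
  Only the two marginals of the coupling enter, because the expectation of a difference splits.
\<close>

lemma expectation_coupling_difference:
  assumes "sampler_coupling \<theta> K" and v: "\<And>i. snd v $ i \<noteq> 0"
  shows "c_weight \<theta> v x * measure_pmf.expectation (K v x) (\<lambda>(xp, xm). f xp - f xm)
       = (\<Sum>y\<in>UNIV. little_kernel \<theta> x y * score \<theta> x y v * f y)"
proof -
  have "measure_pmf.expectation (K v x) (\<lambda>(xp, xm). f xp - f xm)
      = measure_pmf.expectation (map_pmf fst (K v x)) f - measure_pmf.expectation (map_pmf snd (K v x)) f"
    by (simp add: case_prod_beta' integrable_measure_pmf_finite)
  also have "\<dots> = (\<Sum>y\<in>UNIV. (pmf (sampler_plus \<theta> v x) y - pmf (sampler_minus \<theta> v x) y) * f y)"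
  proof -
    have "map_pmf fst (K v x) = sampler_plus \<theta> v x" "map_pmf snd (K v x) = sampler_minus \<theta> v x"
      using assms(1) unfolding sampler_coupling_def by blast+
    then show ?thesis
      by (simp only: expectation_eq_mean mean_def left_diff_distrib sum_subtractf)
  qed
  finally show ?thesis
    by (simp add: sum_distrib_left mult.assoc[symmetric] sampler_difference[OF v])
qed

lemma expectation_estimator:
  fixes \<theta> :: "'n::{finite,linorder} param"
  assumes "sampler_coupling \<theta> K"
  shows "(\<integral>\<omega>. mvd_delta e \<theta> M1 \<omega> *\<^sub>R direction \<omega> \<partial>run_law \<theta> K x M0)
       = (\<Sum>v\<in>set_pmf direction_law. pmf direction_law v *\<^sub>R
           ((\<Sum>x0\<in>UNIV. pmf (little_chain \<theta> x M0) x0 *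
              (\<Sum>y\<in>UNIV. little_kernel \<theta> x0 y * score \<theta> x0 y v *
                (\<Sum>t=0..M1. (average (little_step \<theta>) ^^ t) e y))) *\<^sub>R v))"
proof -
  let ?A = "\<lambda>y. \<Sum>t=0..M1. (average (little_step \<theta>) ^^ t) e y"
  let ?F = "\<lambda>(v, x0, xp, xm). (c_weight \<theta> v x0 * (?A xp - ?A xm)) *\<^sub>R (v :: 'n param)"
  have inner: "measure_pmf.expectation (bind_pmf (K v x0) (\<lambda>(xp, xm). return_pmf (v, x0, xp, xm))) ?F
      = (\<Sum>y\<in>UNIV. little_kernel \<theta> x0 y * score \<theta> x0 y v * ?A y) *\<^sub>R v"
    if "v \<in> set_pmf direction_law" for v x0
  proof -
    have "bind_pmf (K v x0) (\<lambda>(xp, xm). return_pmf (v, x0, xp, xm)) = map_pmf (\<lambda>(xp, xm). (v, x0, xp, xm)) (K v x0)"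
      by (simp add: map_pmf_def case_prod_beta')
    then have "measure_pmf.expectation (bind_pmf (K v x0) (\<lambda>(xp, xm). return_pmf (v, x0, xp, xm))) ?F
        = measure_pmf.expectation (K v x0) (\<lambda>p. (c_weight \<theta> v x0 * (case p of (xp, xm) \<Rightarrow> ?A xp - ?A xm)) *\<^sub>R v)"
      by (simp add: case_prod_beta')
    also have "\<dots> = (c_weight \<theta> v x0 * measure_pmf.expectation (K v x0) (\<lambda>(xp, xm). ?A xp - ?A xm)) *\<^sub>R v"
      by (simp add: integrable_measure_pmf_finite)
    finally show ?thesis
      by (simp only: expectation_coupling_difference[OF assms direction_law_bias_nonzero[OF that]])
  qed
  have "(\<integral>\<omega>. mvd_delta e \<theta> M1 \<omega> *\<^sub>R direction \<omega> \<partial>run_law \<theta> K x M0)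
      = measure_pmf.expectation (start_law \<theta> K x M0) ?F"
    by (simp only: expectation_run_law sum_subtractf)
  also have "\<dots> = (\<Sum>v\<in>set_pmf direction_law. pmf direction_law v *\<^sub>R (\<Sum>x0\<in>UNIV. pmf (little_chain \<theta> x M0) x0 *\<^sub>R
      measure_pmf.expectation (bind_pmf (K v x0) (\<lambda>(xp, xm). return_pmf (v, x0, xp, xm))) ?F))"
    unfolding start_law_def
    by (subst pmf_expectation_bind[OF finite_set_pmf_direction_law],
        (auto simp: set_bind_pmf split: prod.splits)[2],
        intro sum.cong refl arg_cong2[where f = scaleR] pmf_expectation_bind)
       (auto split: prod.splits)
  also have "\<dots> = (\<Sum>v\<in>set_pmf direction_law. pmf direction_law v *\<^sub>R (\<Sum>x0\<in>UNIV. pmf (little_chain \<theta> x M0) x0 *\<^sub>R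
      ((\<Sum>y\<in>UNIV. little_kernel \<theta> x0 y * score \<theta> x0 y v * ?A y) *\<^sub>R v)))"
    by (intro sum.cong refl arg_cong2[where f = scaleR] inner)
  finally have *: "(\<integral>\<omega>. mvd_delta e \<theta> M1 \<omega> *\<^sub>R direction \<omega> \<partial>run_law \<theta> K x M0) = \<dots>" .
  have step: "(\<Sum>x0\<in>UNIV. pmf (little_chain \<theta> x M0) x0 *\<^sub>R (c x0 *\<^sub>R v))
      = (\<Sum>x0\<in>UNIV. pmf (little_chain \<theta> x M0) x0 * c x0) *\<^sub>R v" for c and v :: "'n param"
    by (simp add: scaleR_sum_left)
  show ?thesis
    unfolding * step ..
qed

section \<open>The gradient of the stationary cost and the limit of the estimator\<close>

abbreviation relative_cost :: "'n::finite param \<Rightarrow> ('n state \<Rightarrow> real) \<Rightarrow> 'n state \<Rightarrow> real" where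
  "relative_cost \<theta> e \<equiv> positive_kernel.poisson_solution (little_step \<theta>) (stationary_dist \<theta>) e"

definition cost_derivative :: "('n::finite state \<Rightarrow> real) \<Rightarrow> 'n param \<Rightarrow> 'n param \<Rightarrow> real" where
  "cost_derivative e \<theta> v = (\<Sum>x\<in>UNIV. pmf (stationary_dist \<theta>) x *
     (\<Sum>y\<in>UNIV. little_kernel \<theta> x y * score \<theta> x y v * relative_cost \<theta> e y))"

lemma has_derivative_stationary_cost:
  "(stationary_cost e has_derivative cost_derivative e \<theta>) (at \<theta>)"
proof -
  have "((\<lambda>\<theta>. mean (stationary_dist \<theta>) e) has_derivative cost_derivative e \<theta>) (at \<theta>)"
    unfolding cost_derivative_def[abs_def]
    by (rule has_derivative_stationary_mean[where k = little_step])
       (simp_all add: pmf_little_step little_kernel_pos invariant_stationary_dist has_derivative_little_kernel)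
  then show ?thesis
    by (simp add: stationary_cost_eq_mean[abs_def])
qed

text \<open>
  The left-hand side is the derivative of the total mass 1.
\<close>

lemma sum_little_kernel_score:
  "(\<Sum>y\<in>UNIV. little_kernel \<theta> x y * score \<theta> x y v) = 0"
proof -
  have "((\<lambda>\<theta>. \<Sum>y\<in>UNIV. little_kernel \<theta> x y) has_derivative
      (\<lambda>h. \<Sum>y\<in>UNIV. little_kernel \<theta> x y * score \<theta> x y h)) (at \<theta>)"
    by (intro has_derivative_sum has_derivative_little_kernel)
  moreover have "(\<Sum>y\<in>UNIV. little_kernel \<eta> x y) = 1" for \<eta>
    using sum_pmf_UNIV[of "little_step \<eta> x"] by (simp add: pmf_little_step)
  ultimately have "((\<lambda>\<theta>. 1) has_derivative (\<lambda>h. \<Sum>y\<in>UNIV. little_kernel \<theta> x y * score \<theta> x y h)) (at \<theta>)"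
    by simp
  then have "(\<lambda>h. \<Sum>y\<in>UNIV. little_kernel \<theta> x y * score \<theta> x y h) = (\<lambda>h. 0)"
    by (rule has_derivative_unique[OF _ has_derivative_const])
  then show ?thesis
    by (rule fun_cong)
qed

lemma little_chain_tendsto:
  "(\<lambda>t. pmf (little_chain \<theta> x t) y) \<longlonglongrightarrow> pmf (stationary_dist \<theta>) y"
proof -
  have "(\<lambda>t. mean (little_chain \<theta> x t) (\<lambda>z. of_bool (z = y))) \<longlonglongrightarrow> mean (stationary_dist \<theta>) (\<lambda>z. of_bool (z = y))"
    unfolding mean_little_chain
    by (rule positive_kernel.iterates_tendsto_mean[OF positive_kernel_little_step invariant_stationary_dist])
  then show ?thesis
    by (simp only: mean_indicator)
qed

text \<open>
  The sums of the costs over time diverge in general. As the score weights sum to zero, the stationary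
  mean can be subtracted from every term, and then the series of excesses converges to the Poisson
  solution.
\<close>

lemma score_sums_tendsto:
  "(\<lambda>M. \<Sum>y\<in>UNIV. little_kernel \<theta> x y * score \<theta> x y v * (\<Sum>t=0..M. (average (little_step \<theta>) ^^ t) e y))
     \<longlonglongrightarrow> (\<Sum>y\<in>UNIV. little_kernel \<theta> x y * score \<theta> x y v * relative_cost \<theta> e y)"
proof -
  let ?m = "mean (stationary_dist \<theta>) e"
  let ?A = "\<lambda>t. (average (little_step \<theta>) ^^ t) e"
  have "(\<lambda>M. \<Sum>t=0..M. ?A t y - ?m) \<longlonglongrightarrow> relative_cost \<theta> e y" for y
    using positive_kernel.poisson_solution_sums[OF positive_kernel_little_step invariant_stationary_dist, of \<theta> e y]
    by (simp add: sums_def_le atMost_atLeast0)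
  then have "(\<lambda>M. \<Sum>y\<in>UNIV. little_kernel \<theta> x y * score \<theta> x y v * (\<Sum>t=0..M. ?A t y - ?m))
      \<longlonglongrightarrow> (\<Sum>y\<in>UNIV. little_kernel \<theta> x y * score \<theta> x y v * relative_cost \<theta> e y)"
    by (intro tendsto_intros)
  moreover have "(\<Sum>y\<in>UNIV. little_kernel \<theta> x y * score \<theta> x y v * (\<Sum>t=0..M. ?A t y - ?m))
      = (\<Sum>y\<in>UNIV. little_kernel \<theta> x y * score \<theta> x y v * (\<Sum>t=0..M. ?A t y))" for M
    by (simp add: sum_subtractf right_diff_distrib sum_little_kernel_score flip: sum_distrib_right)
  ultimately show ?thesis
    by simp
qed

theorem proposition5p6:
  fixes \<theta> :: "'n::{finite,linorder} param"
    and e :: "'n state \<Rightarrow> real"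
    and x :: "'n state"
    and K :: "'n param \<Rightarrow> 'n state \<Rightarrow> ('n state \<times> 'n state) pmf"
  assumes "sampler_coupling \<theta> K"
  shows "\<exists>G. (GDERIV (stationary_cost e) \<theta> :> G) \<and>
    ((\<lambda>(M0, M1). \<integral>\<omega>. mvd_delta e \<theta> M1 \<omega> *\<^sub>R direction \<omega> \<partial>run_law \<theta> K x M0) \<longlongrightarrow> G)
      (sequentially \<times>\<^sub>F sequentially)"
proof -
  let ?D = "cost_derivative e \<theta>"
  let ?V = "set_pmf (direction_law :: 'n param pmf)"
  have "linear ?D"
    using has_derivative_stationary_cost has_derivative_linear by blast
  \<comment> \<open>The adjoint of the derivative, applied to 1, is the vector representing it by the inner product.\<close>
  define G where "G = adjoint ?D 1"
  have G: "?D v = inner v G" for v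
    using adjoint_works[OF \<open>linear ?D\<close>, of v 1] by (simp add: G_def inner_commute)
  have "GDERIV (stationary_cost e) \<theta> :> G"
    unfolding gderiv_def G[symmetric] by (rule has_derivative_stationary_cost)
  moreover have "((\<lambda>(M0, M1). \<integral>\<omega>. mvd_delta e \<theta> M1 \<omega> *\<^sub>R direction \<omega> \<partial>run_law \<theta> K x M0)
      \<longlongrightarrow> (\<Sum>v\<in>?V. pmf direction_law v *\<^sub>R (?D v *\<^sub>R v))) (sequentially \<times>\<^sub>F sequentially)"
    unfolding expectation_estimator[OF assms] cost_derivative_def case_prod_beta'
    by (intro tendsto_intros filterlim_compose[OF little_chain_tendsto filterlim_fst]
        filterlim_compose[OF score_sums_tendsto filterlim_snd])
  ultimately show ?thesis
    unfolding G average_over_directions by blast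
qed

end
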